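(* Let $S=\{(\mathbf{x}^i,y^i)\}_{i=1}^n$ be i.i.d. from an unknown distribution $\mathbb{P}_{\mathbf{x},y}$ on $\mathcal{X}\times\mathcal{Y}$, and let $(\tilde{\mathbf{x}}^j,\tilde y^j)$, $j=1,\dots,m$, be i.i.d. from $\mathbb{P}_{\mathbf{x},y}$ and independent of $S$. Let $0\le\delta_p\le\delta_q\le1$, let $\mathcal{B}_0$ be a class of functions $\beta:\mathcal{X}\to\mathcal{Y}$, and for $\tau\in\{\delta_p,\delta_q\}$ let $l^\tau$ be the pinball loss, assumed to take values $l^\tau(\beta(\mathbf{x}),y)\in[0,M]$ for $\beta\in\mathcal{B}_0$. Put $l^\tau_{\mathbb{P}}(\beta)=\mathbb{E}_{\mathbf{x},y}[l^\tau(\beta(\mathbf{x}),y)]$, $l^\tau_S(\beta)=\frac1n\sum_{i=1}^n l^\tau(\beta(\mathbf{x}^i),y^i)$, $\beta^{\tau,*}\in\arg\min_{\beta\in\mathcal{B}_0}l^\tau_{\mathbb{P}}(\beta)$ and $\beta^{\mathrm{Alg},\tau}\in\arg\min_{\beta\in\mathcal{B}_0}l^\tau_S(\beta)$. Let $\mu^\tau$ be the true conditional $\tau$-quantile function, and for each $\tau\in\{\delta_p,\delta_q\}$ let $E^\tau\subseteq\mathcal{Y}$ and $\delta_e^\tau\in[0,1]$ satisfy $$\mathbb{P}_{\mathbf{x}}\big(|\mu^\tau(\mathbf{x})-\beta^{\tau,*}(\mathbf{x})|\in E^\tau\big)\ge1-\delta_e^\tau .$$ Let $\delta\in(0,1)$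 and define, for $\tau\in\{\delta_p,\delta_q\}$, $$\mathcal{B}^\tau=\left\{\beta\in\mathcal{B}_0:\ l^\tau_S(\beta)\le l^\tau_S(\beta^{\mathrm{Alg},\tau})+2\mathcal{R}_S(l^\tau\circ\mathcal{B}_0)+4M\sqrt{\frac{\log\frac3\delta}{2n}}\right\},$$ and $$\mathcal{U}=\prod_{j=1}^m\Big[\inf\{\beta(\tilde{\mathbf{x}}^j):\beta\in\mathcal{B}^{\delta_p}\cup\mathcal{B}^{\delta_q}\}-\sup(E^{\delta_p}\cup E^{\delta_q}),\ \ \sup\{\beta(\tilde{\mathbf{x}}^j):\beta\in\mathcal{B}^{\delta_p}\cup\mathcal{B}^{\delta_q}\}+\sup(E^{\delta_p}\cup E^{\delta_q})\Big].$$ Let $\pi^*$ be an optimal solution of the robust problem $$\min_{\pi\in\Pi}\max_{\mathbf{u}\in\mathcal{U}} f(\pi,\mathbf{u})\quad\text{s.t.}\quad F(\pi,\mathbf{u})\in\mathcal{K}\ \text{ for all }\mathbf{u}\in\mathcal{U}.$$ Then: 1. For $\tau=\delta_p$ and $\tau=\delta_q$ individually, with probability at least $1-\delta$ (over $S$), $\beta^{\tau,*}\in\mathcal{B}^\tau$. 2. $\pi^*$ is feasible for $\{(\tilde{\mathbf{x}}^j,\tilde y^j)\}_{j=1}^m$ with the following probability over $\{(\tilde{\mathbf{x}}^j,\tilde y^j)\}_{j=1}^m$ and $S$: $$\mathbb{P}_{S,\{(\tilde{\mathbf{x}}^j,\tilde y^j)\}_{j=1}^m}\big(F(\pi^*,[\tilde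 y^1\cdots\tilde y^m]^T)\in\mathcal{K}\big)\ge(1-\delta)\Big[(1-\delta_e^{\delta_p})^m+(1-\delta_e^{\delta_q})^m\Big]+(\delta_q-\delta_p)^m-2 .$$
   Context: $\mathcal{X}\subseteq\mathbb{R}^d$ is the feature space and $\mathcal{Y}\subseteq\mathbb{R}$ the label space. The pinball loss with parameter $\tau\in[0,1]$ is $l^\tau(\beta(\mathbf{x}),y)=\tau\,(y-\beta(\mathbf{x}))$ if $y-\beta(\mathbf{x})\ge0$ and $(\tau-1)(y-\beta(\mathbf{x}))$ otherwise. Conditional quantile: $\mu^\tau(\mathbf{x})=\inf\{\mu:\mathbb{P}_{y|\mathbf{x}}(y\le\mu)=\tau\}$. For $\tau\in\{\delta_p,\delta_q\}$ it is assumed that $\mu^\tau$ is well defined and real-valued with $\mathbb{P}_{y|\mathbf{x}}(y\le\mu^\tau(\mathbf{x}))=\tau$, so that $\mathbb{P}_{y|\mathbf{x}}(\mu^{\delta_p}(\mathbf{x})<y\le\mu^{\delta_q}(\mathbf{x}))=\delta_q-\delta_p$. The minimizers $\beta^{\tau,*}$ and $\beta^{\mathrm{Alg},\tau}$ are assumed to exist. If an endpoint of an interval in $\mathcal{U}$ is infinite, the interval is the corresponding unbounded interval in $\mathbb{R}$; $\sup\emptyset:=0$. Decision problem: $\Pi\subseteq\mathbb{R}^{d_1}$ is the set of decisions, $f:\Pi\times\mathbb{R}^m\to\mathbb{R}$ the objective, $F:\Pi\times\mathbb{R}^m\to\mathbb{R}^{d_2}$ the constraint function, and $\mathcal{K}\subseteq\mathbb{R}^{d_2}$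 a convex cone. The solution $\pi^*$ (assumed to exist) depends on $S$ and on $\tilde{\mathbf{x}}^1,\dots,\tilde{\mathbf{x}}^m$ through $\mathcal{U}$. Empirical Rademacher average: for a class $\mathcal{F}$ of real-valued functions and a sample $S'=\{z^i\}_{i=1}^n$, $\mathcal{R}_{S'}(\mathcal{F})=\mathbb{E}_{\sigma^1,\dots,\sigma^n}\big[\frac1n\sup_{g\in\mathcal{F}}\big|\sum_{i=1}^n\sigma^i g(z^i)\big|\big]$, where the $\sigma^i$ are independent and equal to $\pm1$ with probability $1/2$ each. Here $\mathcal{R}_S(l^\tau\circ\mathcal{B}_0)$ is taken for $l^\tau\circ\mathcal{B}_0=\{(\mathbf{x},y)\mapsto l^\tau(\beta(\mathbf{x}),y):\beta\in\mathcal{B}_0\}$ with $z^i=(\mathbf{x}^i,y^i)$. Convention: all sets, functions, suprema and data-dependent selections are taken to be measurable as needed for the probabilities and expectations to make sense. *)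

theory Defs
  imports "HOL-Probability.Probability"
begin

definition pinball :: "real \<Rightarrow> real \<Rightarrow> real \<Rightarrow> real" where
  "pinball \<tau> v y = (if y - v \<ge> 0 then \<tau> * (y - v) else (\<tau> - 1) * (y - v))"

definition loss_class :: "real \<Rightarrow> ('x \<Rightarrow> real) set \<Rightarrow> ('x \<times> real \<Rightarrow> real) set" where
  "loss_class \<tau> \<B> = (\<lambda>\<beta> z. pinball \<tau> (\<beta> (fst z)) (snd z)) ` \<B>"

definition pop_risk :: "('x \<times> real) measure \<Rightarrow> real \<Rightarrow> ('x \<Rightarrow> real) \<Rightarrow> real" where
  "pop_risk D \<tau> \<beta> = (\<integral>z. pinball \<tau> (\<beta> (fst z)) (snd z) \<partial>D)"

text \<open>Samples of size \<open>n\<close> are indexed from \<open>0\<close> to \<open>n - 1\<close> throughout.\<close>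

definition emp_risk :: "nat \<Rightarrow> (nat \<Rightarrow> 'x \<times> real) \<Rightarrow> real \<Rightarrow> ('x \<Rightarrow> real) \<Rightarrow> real" where
  "emp_risk n S \<tau> \<beta> = (1 / real n) * (\<Sum>i<n. pinball \<tau> (\<beta> (fst (S i))) (snd (S i)))"

text \<open>
  The value of the real-valued supremum is only meaningful for a nonempty class
  that is pointwise bounded on the sample, as is the case for a loss class with values in \<open>[0, M]\<close>.
\<close>

definition rademacher :: "nat \<Rightarrow> (nat \<Rightarrow> 'z) \<Rightarrow> ('z \<Rightarrow> real) set \<Rightarrow> real" where
  "rademacher n S G =
     measure_pmf.expectation (Pi_pmf {..<n} 0 (\<lambda>_. pmf_of_set {-1, 1}))
       (\<lambda>\<sigma>. (1 / real n) * (SUP g\<in>G. \<bar>\<Sum>i<n. \<sigma> i * g (S i)\<bar>))"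

text \<open>The class \<open>\<B>\<^sup>\<tau>\<close>; \<open>b\<close> is the empirical risk minimizer \<open>\<beta>\<^sup>A\<^sup>l\<^sup>g\<close>.\<close>

definition confidence_class ::
  "nat \<Rightarrow> real \<Rightarrow> real \<Rightarrow> ('x \<Rightarrow> real) set \<Rightarrow> real \<Rightarrow> (nat \<Rightarrow> 'x \<times> real) \<Rightarrow> ('x \<Rightarrow> real) \<Rightarrow> ('x \<Rightarrow> real) set"
where
  "confidence_class n M \<delta> \<B>0 \<tau> S b =
     {\<beta> \<in> \<B>0. emp_risk n S \<tau> \<beta> \<le> emp_risk n S \<tau> b + 2 * rademacher n S (loss_class \<tau> \<B>0)
                + 4 * M * sqrt (ln (3 / \<delta>) / (2 * real n))}"

definition feature_dist :: "'x::topological_space set \<Rightarrow> ('x \<times> real) measure \<Rightarrow> 'x measure" where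
  "feature_dist X D = distr D (restrict_space borel X) fst"

text \<open>\<open>\<kappa> x\<close> is (a version of) the conditional distribution of the label given the feature \<open>x\<close>.\<close>

definition is_cond_dist ::
  "'x::topological_space set \<Rightarrow> real set \<Rightarrow> ('x \<times> real) measure \<Rightarrow> ('x \<Rightarrow> real measure) \<Rightarrow> bool"
where
  "is_cond_dist X Y D \<kappa> \<longleftrightarrow>
     \<kappa> \<in> restrict_space borel X \<rightarrow>\<^sub>M prob_algebra (restrict_space borel Y) \<and>
     (\<forall>A \<in> sets D. emeasure D A = (\<integral>\<^sup>+x. emeasure (\<kappa> x) (Pair x -` A) \<partial>feature_dist X D))"

text \<open>
  Extended-real infimum, so that an empty or unbounded set of candidates does not
  silently yield some real number.
\<close>

definition cond_quantile :: "('x \<Rightarrow> real measure) \<Rightarrow> real \<Rightarrow> 'x \<Rightarrow> ereal" where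
  "cond_quantile \<kappa> \<tau> x = Inf (ereal ` {u. \<P>(y in \<kappa> x. y \<le> u) = \<tau>})"

definition sup0 :: "real set \<Rightarrow> ereal" where
  "sup0 E = (if E = {} then 0 else Sup (ereal ` E))"

text \<open>
  Endpoints are extended reals, so that an infinite endpoint gives an unbounded interval.
\<close>

definition uncertainty_set ::
  "('x \<Rightarrow> real) set \<Rightarrow> real set \<Rightarrow> ('m \<Rightarrow> 'x) \<Rightarrow> (real ^ 'm) set" where
  "uncertainty_set \<B> E xt =
     {u. \<forall>j. (INF \<beta>\<in>\<B>. ereal (\<beta> (xt j))) - sup0 E \<le> ereal (u $ j) \<and>
             ereal (u $ j) \<le> (SUP \<beta>\<in>\<B>. ereal (\<beta> (xt j))) + sup0 E}"

definition robust_feasible ::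
  "'p set \<Rightarrow> ('p \<Rightarrow> 'u \<Rightarrow> 'k) \<Rightarrow> 'k set \<Rightarrow> 'u set \<Rightarrow> 'p set" where
  "robust_feasible P F K U = {p \<in> P. \<forall>u\<in>U. F p u \<in> K}"

text \<open>
  The worst-case objective is the extended-real supremum over \<open>U\<close>, which is the maximum
  whenever that is attained.
\<close>

definition robust_optimal ::
  "'p set \<Rightarrow> ('p \<Rightarrow> 'u \<Rightarrow> real) \<Rightarrow> ('p \<Rightarrow> 'u \<Rightarrow> 'k) \<Rightarrow> 'k set \<Rightarrow> 'u set \<Rightarrow> 'p \<Rightarrow> bool" where
  "robust_optimal P f F K U p \<longleftrightarrow>
     is_arg_min (\<lambda>p. SUP u\<in>U. ereal (f p u)) (\<lambda>p. p \<in> robust_feasible P F K U) p"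

end

theory Submission
  imports Defs
begin

text \<open>
  Both claims rest on one concentration inequality. Write \<open>g\<^sub>0\<close> for the loss of the population
  minimizer, \<open>a\<close> for the loss of the empirical one, \<open>\<phi>(S)\<close> for the largest excess over the class of
  the population mean over the sample mean, and \<open>R(S)\<close> for the empirical Rademacher average. Since
  \<open>g\<^sub>0\<close> has the smaller population mean, the empirical risk of \<open>g\<^sub>0\<close> exceeds that of \<open>a\<close> by at most

    \<open>h(S) + 2 R(S)\<close>,  where  \<open>h(S) = (sample mean of g\<^sub>0 - mean of g\<^sub>0) + \<phi>(S) - 2 R(S)\<close>.

  Symmetrization gives \<open>h\<close> a nonpositive expectation: replacing population means by the means of an
  independent ghost sample and exchanging the two samples coordinatewise by random signs bounds the
  expectation of \<open>\<phi>\<close> by twice that of \<open>R\<close>. Changing one sample point moves the sample mean, \<open>\<phi>\<close> and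
  \<open>R\<close> by at most \<open>M / n\<close> each, hence \<open>h\<close> by at most \<open>4 M / n\<close>. McDiarmid's inequality, applied once
  to \<open>h\<close>, therefore yields \<open>h(S) < 4 M sqrt (L / (2 n))\<close> with probability at least \<open>1 - exp (- L)\<close>. For
  \<open>L = ln (3 / \<delta>)\<close> this probability is \<open>1 - \<delta> / 3\<close>, more than the first claim asks for. (The usual
  three separate deviation bounds, each with failure probability \<open>\<delta> / 3\<close>, give the same radius.)

  For the second claim, three events suffice. For each of the two levels, the confidence class contains
  the population minimizer, an event of the sample \<open>S\<close>, and at every test point the minimizer is as
  close to the quantile function as \<open>E\<close> requires, an independent event of the test points. The third
  event is that every test label lies between the two conditional quantiles. When all three
  occur, each label is bounded below by the lower quantile, hence by a member of the confidence class
  minus an element of \<open>E\<close>, and similarly above; so the label vector lies in the uncertainty set and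
  robust feasibility applies to it. The bound is the union bound for these three events.
\<close>

section \<open>Bounded differences\<close>

text \<open>
  Induction on the number of coordinates: integrating out one coordinate leaves a function \<open>g\<close> of the
  others that inherits their bounded differences. For fixed other coordinates, \<open>f\<close> stays within an
  interval of length \<open>c j\<close> as coordinate \<open>j\<close> varies, so Hoeffding's lemma bounds the moment generating
  function of \<open>f - g\<close> by a constant, which factors out of the remaining integral.
\<close>

lemma nn_integral_exp_deviation_le:
  fixes M :: "'i \<Rightarrow> 'a measure"
  assumes "finite I" and M: "\<And>i. prob_space (M i)"
    and f: "f \<in> borel_measurable (PiM I M)"
    and B: "\<And>x. x \<in> space (PiM I M) \<Longrightarrow> \<bar>f x\<bar> \<le> B"
    and diff: "\<And>x i y. \<lbrakk>x \<in> space (PiM I M); i \<in> I; y \<in> space (M i)\<rbrakk> \<Longrightarrow> \<bar>f (x(i := y)) - f x\<bar> \<le> c i"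
    and s: "s > 0"
  shows "(\<integral>\<^sup>+x. ennreal (exp (s * (f x - (\<integral>x. f x \<partial>PiM I M)))) \<partial>PiM I M)
      \<le> ennreal (exp (s\<^sup>2 * (\<Sum>i\<in>I. (c i)\<^sup>2) / 8))"
  using \<open>finite I\<close> f B diff
proof (induction I arbitrary: f rule: finite_induct)
  case empty
  interpret product_prob_space M by (simp add: M product_prob_spaceI)
  have "f x = f (\<lambda>_. undefined)" if "x \<in> space (PiM {} M)" for x
    using that by (simp add: space_PiM)
  then have "(\<integral>x. f x \<partial>PiM {} M) = f (\<lambda>_. undefined)"
    by (simp add: PiM_empty lebesgue_integral_count_space_finite)
  then show ?case
    by (simp add: PiM_empty nn_integral_count_space_finite)
next
  case (insert j I)
  interpret product_prob_space M by (simp add: M product_prob_spaceI)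
  interpret PI: prob_space "PiM I M" by (simp add: M prob_space_PiM)
  interpret PI': prob_space "PiM (insert j I) M" by (simp add: M prob_space_PiM)
  note [measurable] = insert.prems(1)
  have upd: "x(j := y) \<in> space (PiM (insert j I) M)"
    if "x \<in> space (PiM I M)" "y \<in> space (M j)" for x y
    using that by (auto simp: space_PiM PiE_iff extensional_def)
  define g where "g x = (\<integral>y. f (x(j := y)) \<partial>M j)" for x
  have f_upd [measurable]: "(\<lambda>y. f (x(j := y))) \<in> borel_measurable (M j)"
    if [measurable]: "x \<in> space (PiM I M)" for x
    using that by measurable
  have int_f: "integrable (M j) (\<lambda>y. f (x(j := y)))" if "x \<in> space (PiM I M)" for x
    by (rule finite_measure.integrable_const_bound[where B = B])
       (use insert.prems(2) upd that M in \<open>auto intro!: AE_I2 f_upd prob_space.finite_measure\<close>)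
  have g_meas [measurable]: "g \<in> borel_measurable (PiM I M)"
    unfolding g_def by measurable
  have g_bound: "\<bar>g x\<bar> \<le> B" if "x \<in> space (PiM I M)" for x
  proof -
    have "\<bar>g x\<bar> \<le> (\<integral>y. \<bar>f (x(j := y))\<bar> \<partial>M j)"
      unfolding g_def by (rule integral_abs_bound)
    also have "\<dots> \<le> (\<integral>y. B \<partial>M j)"
      by (rule integral_mono) (use int_f insert.prems(2) upd that in auto)
    finally show ?thesis by (simp add: prob_space.prob_space[OF M])
  qed
  have g_diff: "\<bar>g (x(i := z)) - g x\<bar> \<le> c i"
    if x: "x \<in> space (PiM I M)" and i: "i \<in> I" and z: "z \<in> space (M i)" for x i z
  proof -
    have x': "x(i := z) \<in> space (PiM I M)"
      using x i z by (auto simp: space_PiM PiE_iff extensional_def)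
    have "i \<noteq> j" using i insert.hyps by auto
    then have swap: "x(i := z, j := y) = x(j := y, i := z)" for y
      by (rule fun_upd_twist)
    have "\<bar>g (x(i := z)) - g x\<bar> = \<bar>\<integral>y. f (x(i := z, j := y)) - f (x(j := y)) \<partial>M j\<bar>"
      unfolding g_def using int_f x x' by simp
    also have "\<dots> \<le> (\<integral>y. \<bar>f (x(i := z, j := y)) - f (x(j := y))\<bar> \<partial>M j)"
      by (rule integral_abs_bound)
    also have "\<dots> \<le> (\<integral>y. c i \<partial>M j)"
    proof (rule integral_mono)
      show "integrable (M j) (\<lambda>y. \<bar>f (x(i := z, j := y)) - f (x(j := y))\<bar>)"
        by (intro integrable_abs Bochner_Integration.integrable_diff int_f x x')
      show "\<bar>f (x(i := z, j := y)) - f (x(j := y))\<bar> \<le> c i" if "y \<in> space (M j)" for y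
        unfolding swap using insert.prems(3)[OF upd[OF x that] _ z] i by blast
    qed simp
    finally show ?thesis by (simp add: prob_space.prob_space[OF M])
  qed
  have int_f_P: "integrable (PiM (insert j I) M) f"
    by (rule PI'.integrable_const_bound[where B = B]) (use insert.prems(2) in auto)
  then have mean: "(\<integral>x. f x \<partial>PiM (insert j I) M) = (\<integral>x. g x \<partial>PiM I M)"
    unfolding g_def using insert.hyps by (intro product_integral_insert) auto
  define m where "m = (\<integral>x. g x \<partial>PiM I M)"
  have inner: "(\<integral>\<^sup>+y. ennreal (exp (s * (f (x(j := y)) - g x))) \<partial>M j) \<le> ennreal (exp (s\<^sup>2 * (c j)\<^sup>2 / 8))"
    if x: "x \<in> space (PiM I M)" for x
  proof -
    define a where "a = (INF y\<in>space (M j). f (x(j := y)))"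
    have bdd: "bdd_below ((\<lambda>y. f (x(j := y))) ` space (M j))"
    proof (rule bdd_belowI2[where m = "-B"])
      show "- B \<le> f (x(j := y))" if "y \<in> space (M j)" for y
        using insert.prems(2)[OF upd[OF x that]] by linarith
    qed
    have "f (x(j := y)) - c j \<le> a" if y: "y \<in> space (M j)" for y
      unfolding a_def
    proof (rule cINF_greatest)
      fix z assume z: "z \<in> space (M j)"
      show "f (x(j := y)) - c j \<le> f (x(j := z))"
        using insert.prems(3)[OF upd[OF x z] insertI1 y] unfolding fun_upd_upd by linarith
    qed (rule prob_space.not_empty[OF M])
    moreover have "a \<le> f (x(j := y))" if "y \<in> space (M j)" for y
      unfolding a_def by (rule cINF_lower[OF bdd that])
    ultimately have range: "AE y in M j. f (x(j := y)) \<in> {a..a + c j}"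
      by (intro AE_I2) (force simp: algebra_simps)
    interpret h: interval_bounded_random_variable "M j" "\<lambda>y. f (x(j := y))" a "a + c j"
      by unfold_locales (use range x in auto)
    show ?thesis
      using h.Hoeffdings_lemma_nn_integral[OF s] by (simp add: g_def)
  qed
  have "(\<integral>\<^sup>+x. ennreal (exp (s * (f x - m))) \<partial>PiM (insert j I) M)
      = (\<integral>\<^sup>+x. (\<integral>\<^sup>+y. ennreal (exp (s * (f (x(j := y)) - m))) \<partial>M j) \<partial>PiM I M)"
    using insert.hyps by (intro product_nn_integral_insert) auto
  also have "\<dots> = (\<integral>\<^sup>+x. (\<integral>\<^sup>+y. ennreal (exp (s * (g x - m))) * ennreal (exp (s * (f (x(j := y)) - g x))) \<partial>M j) \<partial>PiM I M)"
    by (intro nn_integral_cong)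
       (simp add: ennreal_mult'[symmetric] mult_exp_exp algebra_simps)
  also have "\<dots> = (\<integral>\<^sup>+x. ennreal (exp (s * (g x - m))) * (\<integral>\<^sup>+y. ennreal (exp (s * (f (x(j := y)) - g x))) \<partial>M j) \<partial>PiM I M)"
    by (intro nn_integral_cong nn_integral_cmult) auto
  also have "\<dots> \<le> (\<integral>\<^sup>+x. ennreal (exp (s * (g x - m))) * ennreal (exp (s\<^sup>2 * (c j)\<^sup>2 / 8)) \<partial>PiM I M)"
    by (intro nn_integral_mono mult_left_mono inner) auto
  also have "\<dots> = (\<integral>\<^sup>+x. ennreal (exp (s * (g x - m))) \<partial>PiM I M) * ennreal (exp (s\<^sup>2 * (c j)\<^sup>2 / 8))"
    by (intro nn_integral_multc) auto
  also have "\<dots> \<le> ennreal (exp (s\<^sup>2 * (\<Sum>i\<in>I. (c i)\<^sup>2) / 8)) * ennreal (exp (s\<^sup>2 * (c j)\<^sup>2 / 8))"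
    unfolding m_def by (intro mult_right_mono insert.IH g_bound g_diff) auto
  also have "\<dots> = ennreal (exp (s\<^sup>2 * (\<Sum>i\<in>insert j I. (c i)\<^sup>2) / 8))"
    using insert.hyps
    by (simp add: ennreal_mult'[symmetric] mult_exp_exp algebra_simps add_divide_distrib)
  finally show ?case unfolding mean m_def .
qed

text \<open>
  Chernoff's method applied to the bound on the moment generating function.
\<close>

theorem McDiarmid_inequality:
  fixes M :: "'i \<Rightarrow> 'a measure"
  assumes "finite I" and M: "\<And>i. prob_space (M i)"
    and f [measurable]: "f \<in> borel_measurable (PiM I M)"
    and B: "\<And>x. x \<in> space (PiM I M) \<Longrightarrow> \<bar>f x\<bar> \<le> B"
    and diff: "\<And>x i y. \<lbrakk>x \<in> space (PiM I M); i \<in> I; y \<in> space (M i)\<rbrakk> \<Longrightarrow> \<bar>f (x(i := y)) - f x\<bar> \<le> c i"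
    and t: "t > 0" and c: "(\<Sum>i\<in>I. (c i)\<^sup>2) > 0"
  shows "measure (PiM I M) {x \<in> space (PiM I M). f x \<ge> (\<integral>x. f x \<partial>PiM I M) + t}
      \<le> exp (- 2 * t\<^sup>2 / (\<Sum>i\<in>I. (c i)\<^sup>2))"
proof -
  interpret prob_space "PiM I M" by (simp add: M prob_space_PiM)
  define m where "m = (\<integral>x. f x \<partial>PiM I M)"
  define C where "C = (\<Sum>i\<in>I. (c i)\<^sup>2)"
  \<comment> \<open>the minimiser of the exponent \<open>s\<^sup>2 * C / 8 - s * t\<close>\<close>
  define s where "s = 4 * t / C"
  have s: "s > 0" using t c by (simp add: s_def C_def)
  have "emeasure (PiM I M) {x \<in> space (PiM I M). f x \<ge> m + t}
      \<le> ennreal (exp (- s * t)) * (\<integral>\<^sup>+x. ennreal (exp (s * (f x - m))) \<partial>PiM I M)"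
    (is "emeasure _ ?A \<le> _")
  proof -
    have "emeasure (PiM I M) ?A = (\<integral>\<^sup>+x. indicator ?A x \<partial>PiM I M)"
      by simp
    also have "\<dots> \<le> (\<integral>\<^sup>+x. ennreal (exp (- s * t)) * ennreal (exp (s * (f x - m))) \<partial>PiM I M)"
    proof (rule nn_integral_mono)
      fix x
      have "1 \<le> exp (- s * t) * exp (s * (f x - m))" if "x \<in> ?A"
      proof -
        have "s * t \<le> s * (f x - m)" using that s by (intro mult_left_mono) auto
        then show ?thesis by (simp add: mult_exp_exp)
      qed
      then show "indicator ?A x \<le> ennreal (exp (- s * t)) * ennreal (exp (s * (f x - m)))"
        by (auto simp: indicator_def ennreal_mult'[symmetric] simp del: ennreal_1 simp flip: ennreal_1)
    qed
    also have "\<dots> = ennreal (exp (- s * t)) * (\<integral>\<^sup>+x. ennreal (exp (s * (f x - m))) \<partial>PiM I M)"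
      by (intro nn_integral_cmult) auto
    finally show ?thesis .
  qed
  also have "\<dots> \<le> ennreal (exp (- s * t)) * ennreal (exp (s\<^sup>2 * C / 8))"
    unfolding m_def C_def
    by (intro mult_left_mono nn_integral_exp_deviation_le[where B = B] assms s) auto
  also have "\<dots> = ennreal (exp (s\<^sup>2 * C / 8 - s * t))"
    by (simp add: ennreal_mult'[symmetric] mult_exp_exp)
  also have "s\<^sup>2 * C / 8 - s * t = - 2 * t\<^sup>2 / C"
    using c unfolding s_def C_def[symmetric] by (simp add: field_simps power2_eq_square)
  finally show ?thesis
    by (simp add: emeasure_eq_measure m_def C_def)
qed

section \<open>Disjoint subsamples\<close>

text \<open>
  Coordinates of a product measure at disjoint positions are independent. The point for symmetrization
  is that the joint law does not depend on which positions are used, so two samples taken from one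
  doubled sample may exchange any of their entries without changing their joint law.
\<close>

lemma distr_PiM_disjoint_reindex:
  fixes D :: "'a measure" and f g :: "'i \<Rightarrow> 'k"
  assumes D: "prob_space D" and K: "K \<noteq> {}"
    and f: "inj_on f I" "f ` I \<subseteq> K" and g: "inj_on g J" "g ` J \<subseteq> K" and disj: "f ` I \<inter> g ` J = {}"
  shows "distr (PiM K (\<lambda>_. D)) (PiM I (\<lambda>_. D) \<Otimes>\<^sub>M PiM J (\<lambda>_. D))
      (\<lambda>\<omega>. (\<lambda>i\<in>I. \<omega> (f i), \<lambda>j\<in>J. \<omega> (g j))) = PiM I (\<lambda>_. D) \<Otimes>\<^sub>M PiM J (\<lambda>_. D)"
proof -
  let ?Q = "PiM K (\<lambda>_. D)"
  interpret Q: prob_space ?Q by (simp add: D prob_space_PiM)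
  have ind: "Q.indep_vars (\<lambda>_. D) (\<lambda>k \<omega>. \<omega> k) K"
  proof (subst Q.indep_vars_iff_distr_eq_PiM'[OF K])
    have "distr ?Q ?Q (\<lambda>x. \<lambda>i\<in>K. x i) = distr ?Q ?Q (\<lambda>x. x)"
      by (rule distr_cong) (auto simp: space_PiM PiE_restrict)
    also have "\<dots> = (\<Pi>\<^sub>M i\<in>K. distr ?Q D (\<lambda>x. x i))"
      by (subst distr_id) (auto intro!: PiM_cong distr_PiM_component[symmetric] simp: D)
    finally show "distr ?Q ?Q (\<lambda>x. \<lambda>i\<in>K. x i) = (\<Pi>\<^sub>M i\<in>K. distr ?Q D (\<lambda>x. x i))" .
  qed auto
  have f_fun: "f \<in> I \<rightarrow> K" and g_fun: "g \<in> J \<rightarrow> K" using f g by auto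
  have "Q.indep_var (PiM I (\<lambda>_. D))
      ((\<lambda>\<omega>. \<lambda>i\<in>I. \<omega> (f i)) \<circ> (\<lambda>\<omega>. restrict (\<lambda>k. \<omega> k) (f ` I)))
      (PiM J (\<lambda>_. D)) ((\<lambda>\<omega>. \<lambda>j\<in>J. \<omega> (g j)) \<circ> (\<lambda>\<omega>. restrict (\<lambda>k. \<omega> k) (g ` J)))"
    by (rule Q.indep_var_compose[OF Q.indep_var_restrict[OF ind disj f(2) g(2)]])
       (auto intro!: measurable_restrict measurable_component_singleton)
  moreover have "(\<lambda>\<omega> :: 'k \<Rightarrow> 'a. \<lambda>i\<in>I. \<omega> (f i)) \<circ> (\<lambda>\<omega>. restrict (\<lambda>k. \<omega> k) (f ` I)) = (\<lambda>\<omega>. \<lambda>i\<in>I. \<omega> (f i))"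
    "(\<lambda>\<omega> :: 'k \<Rightarrow> 'a. \<lambda>i\<in>J. \<omega> (g i)) \<circ> (\<lambda>\<omega>. restrict (\<lambda>k. \<omega> k) (g ` J)) = (\<lambda>\<omega>. \<lambda>j\<in>J. \<omega> (g j))"
    by (auto simp: fun_eq_iff)
  ultimately have "Q.indep_var (PiM I (\<lambda>_. D)) (\<lambda>\<omega>. \<lambda>i\<in>I. \<omega> (f i)) (PiM J (\<lambda>_. D)) (\<lambda>\<omega>. \<lambda>j\<in>J. \<omega> (g j))"
    by (simp only:)
  then show ?thesis
    using distr_PiM_reindex[of K "\<lambda>_. D" f I] distr_PiM_reindex[of K "\<lambda>_. D" g J] f g f_fun g_fun D
    by (simp add: Q.indep_var_distribution_eq)
qed

section \<open>Symmetrization\<close>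

lemma abs_SUP_diff_le:
  fixes a b :: "'a \<Rightarrow> real"
  assumes "A \<noteq> {}" and bdd: "bdd_above (a ` A)" "bdd_above (b ` A)"
    and diff: "\<And>x. x \<in> A \<Longrightarrow> \<bar>a x - b x\<bar> \<le> c"
  shows "\<bar>(SUP x\<in>A. a x) - (SUP x\<in>A. b x)\<bar> \<le> c"
proof -
  have le: "(SUP x\<in>A. u x) \<le> (SUP x\<in>A. v x) + c"
    if "bdd_above (v ` A)" "\<And>x. x \<in> A \<Longrightarrow> \<bar>u x - v x\<bar> \<le> c" for u v
  proof (rule cSUP_least)
    fix x assume x: "x \<in> A"
    have "u x \<le> v x + c" using that(2)[OF x] by linarith
    also have "v x \<le> (SUP x\<in>A. v x)" by (rule cSUP_upper[OF x that(1)])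
    finally show "u x \<le> (SUP x\<in>A. v x) + c" by simp
  qed fact
  show ?thesis
    using le[OF bdd(2) diff] le[OF bdd(1), of b] diff by (force simp: abs_minus_commute abs_le_iff)
qed

text \<open>
  The Rademacher average is an expectation over a finite set of sign vectors; as a finite sum it
  commutes with integration over the sample without any joint measurability argument.
\<close>

abbreviation sign_pmf :: "nat \<Rightarrow> (nat \<Rightarrow> real) pmf" where
  "sign_pmf n \<equiv> Pi_pmf {..<n} 0 (\<lambda>_. pmf_of_set {-1, 1})"

lemma set_sign_pmf: "set_pmf (sign_pmf n) = PiE_dflt {..<n} 0 (\<lambda>_. {-1, 1})"
  by (simp add: set_Pi_pmf comp_def)

lemma finite_set_sign_pmf: "finite (set_pmf (sign_pmf n))"
  unfolding set_sign_pmf by (rule finite_PiE_dflt) auto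

lemma expectation_sign_pmf:
  fixes h :: "(nat \<Rightarrow> real) \<Rightarrow> real"
  shows "measure_pmf.expectation (sign_pmf n) h = (\<Sum>\<sigma>\<in>set_pmf (sign_pmf n). pmf (sign_pmf n) \<sigma> * h \<sigma>)"
  by (subst integral_measure_pmf[OF finite_set_sign_pmf]) auto

lemma sum_sign_pmf: "(\<Sum>\<sigma>\<in>set_pmf (sign_pmf n). pmf (sign_pmf n) \<sigma>) = 1"
  by (rule sum_pmf_eq_1[OF finite_set_sign_pmf]) simp

lemma sign_cases: "\<sigma> \<in> set_pmf (sign_pmf n) \<Longrightarrow> i < n \<Longrightarrow> \<sigma> i = -1 \<or> \<sigma> i = 1"
  by (auto simp: set_sign_pmf PiE_dflt_def)

definition sample_mean :: "nat \<Rightarrow> (nat \<Rightarrow> 'z) \<Rightarrow> ('z \<Rightarrow> real) \<Rightarrow> real" where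
  "sample_mean n S g = (1 / real n) * (\<Sum>i<n. g (S i))"

text \<open>
  Suprema over an uncountable class are not measurable automatically, so the measurability of the
  three suprema that are integrated below is part of the assumptions.
\<close>

locale bounded_class = prob_space D for D :: "'z measure" +
  fixes n :: nat and G :: "('z \<Rightarrow> real) set" and M :: real
  assumes n_pos: "n \<ge> 1"
    and G_nonempty: "G \<noteq> {}"
    and G_measurable: "g \<in> G \<Longrightarrow> g \<in> borel_measurable D"
    and G_range: "\<lbrakk>g \<in> G; z \<in> space D\<rbrakk> \<Longrightarrow> g z \<in> {0..M}"
    and rademacher_measurable:
      "(\<lambda>S. rademacher n S G) \<in> borel_measurable (\<Pi>\<^sub>M i\<in>{..<n}. D)"
    and deviation_measurable:
      "(\<lambda>S. SUP g\<in>G. expectation g - sample_mean n S g) \<in> borel_measurable (\<Pi>\<^sub>M i\<in>{..<n}. D)"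
    and ghost_deviation_measurable:
      "(\<lambda>(S', S). SUP g\<in>G. sample_mean n S' g - sample_mean n S g)
        \<in> borel_measurable ((\<Pi>\<^sub>M i\<in>{..<n}. D) \<Otimes>\<^sub>M (\<Pi>\<^sub>M i\<in>{..<n}. D))"
begin

abbreviation P :: "(nat \<Rightarrow> 'z) measure" where
  "P \<equiv> \<Pi>\<^sub>M i\<in>{..<n}. D"

definition deviation :: "(nat \<Rightarrow> 'z) \<Rightarrow> real" where
  "deviation S = (SUP g\<in>G. expectation g - sample_mean n S g)"

definition ghost_deviation :: "(nat \<Rightarrow> 'z) \<Rightarrow> (nat \<Rightarrow> 'z) \<Rightarrow> real" where
  "ghost_deviation S' S = (SUP g\<in>G. sample_mean n S' g - sample_mean n S g)"

definition signed_sup :: "(nat \<Rightarrow> 'z) \<Rightarrow> (nat \<Rightarrow> real) \<Rightarrow> real" where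
  "signed_sup S \<sigma> = (1 / real n) * (SUP g\<in>G. \<bar>\<Sum>i<n. \<sigma> i * g (S i)\<bar>)"

lemma rademacher_eq:
  "rademacher n S G = (\<Sum>\<sigma>\<in>set_pmf (sign_pmf n). pmf (sign_pmf n) \<sigma> * signed_sup S \<sigma>)"
  unfolding rademacher_def signed_sup_def by (rule expectation_sign_pmf)

sublocale sample: prob_space P
  by (intro prob_space_PiM prob_space_axioms)

sublocale ghost: pair_prob_space P P ..

lemma sample_space: "S \<in> space P \<Longrightarrow> i < n \<Longrightarrow> S i \<in> space D"
  by (auto simp: space_PiM)

lemma sample_mean_range: "S \<in> space P \<Longrightarrow> g \<in> G \<Longrightarrow> sample_mean n S g \<in> {0..M}"
proof -
  assume S: "S \<in> space P" and g: "g \<in> G"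
  have *: "0 \<le> g (S i) \<and> g (S i) \<le> M" if "i < n" for i
    using G_range[OF g sample_space[OF S that]] by simp
  have "0 \<le> (\<Sum>i<n. g (S i))" "(\<Sum>i<n. g (S i)) \<le> (\<Sum>i<n. M)"
    by (rule sum_nonneg, use * in simp) (rule sum_mono, use * in simp)
  then show ?thesis
    using n_pos by (simp add: sample_mean_def field_simps)
qed

lemma G_integrable: "g \<in> G \<Longrightarrow> integrable D g"
  by (rule integrable_const_bound[where B = M])
     (use G_range G_measurable in fastforce)+

lemma expectation_range: "g \<in> G \<Longrightarrow> expectation g \<in> {0..M}"
  using G_range integral_ge_const[OF G_integrable, of g 0] integral_le_const[OF G_integrable, of g M]
  by auto

lemma sample_mean_measurable [measurable]: "g \<in> G \<Longrightarrow> (\<lambda>S. sample_mean n S g) \<in> borel_measurable P"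
  unfolding sample_mean_def using G_measurable by measurable

lemma sample_mean_integrable: "g \<in> G \<Longrightarrow> integrable P (\<lambda>S. sample_mean n S g)"
  by (rule sample.integrable_const_bound[where B = M])
     (use sample_mean_range in fastforce)+

lemma expectation_sample_mean:
  assumes g: "g \<in> G" shows "(\<integral>S. sample_mean n S g \<partial>P) = expectation g"
proof -
  have [measurable]: "g \<in> borel_measurable D" by (rule G_measurable[OF g])
  have comp: "distr P D (\<lambda>S. S i) = D" if "i < n" for i
    using that by (intro distr_PiM_component prob_space_axioms) auto
  have int: "integrable P (\<lambda>S. g (S i))" if "i < n" for i
    using integrable_distr[of "\<lambda>S. S i" P D g] G_integrable[OF g] comp[OF that] that by simp
  have "(\<integral>S. g (S i) \<partial>P) = expectation g" if "i < n" for i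
  proof -
    have "(\<integral>S. g (S i) \<partial>P) = (\<integral>z. g z \<partial>distr P D (\<lambda>S. S i))"
      using that by (subst integral_distr) auto
    then show ?thesis by (simp add: comp that)
  qed
  then show ?thesis
    unfolding sample_mean_def using n_pos int by (simp add: Bochner_Integration.integral_sum)
qed

lemma bdd_above_deviation: "S \<in> space P \<Longrightarrow> bdd_above ((\<lambda>g. expectation g - sample_mean n S g) ` G)"
  using expectation_range sample_mean_range by (intro bdd_aboveI2[where M = M]) force

lemma bdd_above_ghost_deviation:
  "S \<in> space P \<Longrightarrow> S' \<in> space P \<Longrightarrow> bdd_above ((\<lambda>g. sample_mean n S' g - sample_mean n S g) ` G)"
  using sample_mean_range[of S] sample_mean_range[of S'] by (intro bdd_aboveI2[where M = M]) force

lemma signed_sum_le: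
  assumes "\<sigma> \<in> set_pmf (sign_pmf n)" "S \<in> space P" "g \<in> G"
  shows "\<bar>\<Sum>i<n. \<sigma> i * g (S i)\<bar> \<le> real n * M"
proof -
  have "\<bar>\<Sum>i<n. \<sigma> i * g (S i)\<bar> \<le> (\<Sum>i<n. \<bar>\<sigma> i * g (S i)\<bar>)" by (rule sum_abs)
  also have "\<dots> \<le> (\<Sum>i<n. M)"
    using G_range[OF assms(3) sample_space[OF assms(2)]] sign_cases[OF assms(1)]
    by (intro sum_mono) (fastforce simp: abs_mult)
  finally show ?thesis by simp
qed

lemma bdd_above_signed:
  "\<sigma> \<in> set_pmf (sign_pmf n) \<Longrightarrow> S \<in> space P \<Longrightarrow> bdd_above ((\<lambda>g. \<bar>\<Sum>i<n. \<sigma> i * g (S i)\<bar>) ` G)"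
  using signed_sum_le by (intro bdd_aboveI2)

lemma cSUP_abs_le:
  fixes a :: "('z \<Rightarrow> real) \<Rightarrow> real"
  assumes "\<And>g. g \<in> G \<Longrightarrow> \<bar>a g\<bar> \<le> c"
  shows "\<bar>SUP g\<in>G. a g\<bar> \<le> c"
proof -
  have "\<bar>(SUP g\<in>G. a g) - (SUP g\<in>G. 0)\<bar> \<le> c"
  proof (rule abs_SUP_diff_le[OF G_nonempty])
    show "bdd_above (a ` G)"
      using assms by (intro bdd_aboveI2[where M = c]) (simp add: abs_le_iff)
  qed (use assms in auto)
  then show ?thesis using G_nonempty by simp
qed

lemma deviation_bound: "S \<in> space P \<Longrightarrow> \<bar>deviation S\<bar> \<le> M"
  unfolding deviation_def using expectation_range sample_mean_range
  by (intro cSUP_abs_le) (force simp: abs_le_iff)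

lemma ghost_deviation_bound: "S \<in> space P \<Longrightarrow> S' \<in> space P \<Longrightarrow> \<bar>ghost_deviation S' S\<bar> \<le> M"
  unfolding ghost_deviation_def using sample_mean_range[of S] sample_mean_range[of S']
  by (intro cSUP_abs_le) (force simp: abs_le_iff)

lemma signed_sup_range:
  assumes "\<sigma> \<in> set_pmf (sign_pmf n)" "S \<in> space P"
  shows "signed_sup S \<sigma> \<in> {0..M}"
proof -
  obtain g where g: "g \<in> G" using G_nonempty by blast
  have "0 \<le> \<bar>\<Sum>i<n. \<sigma> i * g (S i)\<bar>" by simp
  also have "\<dots> \<le> (SUP g\<in>G. \<bar>\<Sum>i<n. \<sigma> i * g (S i)\<bar>)"
    by (rule cSUP_upper[OF g bdd_above_signed[OF assms]])
  finally have "0 \<le> (SUP g\<in>G. \<bar>\<Sum>i<n. \<sigma> i * g (S i)\<bar>)" .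
  moreover have "(SUP g\<in>G. \<bar>\<Sum>i<n. \<sigma> i * g (S i)\<bar>) \<le> real n * M"
    by (intro cSUP_least G_nonempty signed_sum_le assms)
  ultimately show ?thesis using n_pos by (simp add: signed_sup_def field_simps)
qed

lemma rademacher_range:
  assumes "S \<in> space P" shows "rademacher n S G \<in> {0..M}"
proof -
  have "rademacher n S G \<le> (\<Sum>\<sigma>\<in>set_pmf (sign_pmf n). pmf (sign_pmf n) \<sigma> * M)"
    unfolding rademacher_eq using signed_sup_range assms by (intro sum_mono mult_left_mono) auto
  then show ?thesis
    using signed_sup_range[OF _ assms] sum_sign_pmf
    by (auto simp: rademacher_eq sum_distrib_right[symmetric] intro!: sum_nonneg mult_nonneg_nonneg)
qed

text \<open>
  A population mean is the expected mean of an independent ghost sample \<open>S'\<close>, and a supremum of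
  expectations is at most the expectation of the supremum.
\<close>

lemma deviation_le_ghost:
  assumes S: "S \<in> space P"
  shows "deviation S \<le> (\<integral>S'. ghost_deviation S' S \<partial>P)"
  unfolding deviation_def
proof (rule cSUP_least[OF G_nonempty])
  fix g assume g: "g \<in> G"
  have [measurable]: "(\<lambda>S'. ghost_deviation S' S) \<in> borel_measurable P"
    using measurable_compose[OF measurable_Pair2'[OF S] ghost_deviation_measurable]
    by (simp add: ghost_deviation_def)
  have "expectation g - sample_mean n S g = (\<integral>S'. sample_mean n S' g - sample_mean n S g \<partial>P)"
    using expectation_sample_mean[OF g] sample_mean_integrable[OF g] by (simp add: sample.prob_space)
  also have "\<dots> \<le> (\<integral>S'. ghost_deviation S' S \<partial>P)"
  proof (rule integral_mono)
    show "integrable P (\<lambda>S'. ghost_deviation S' S)"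
      by (rule sample.integrable_const_bound[where B = M]) (use ghost_deviation_bound S in auto)
    show "sample_mean n S' g - sample_mean n S g \<le> ghost_deviation S' S" if "S' \<in> space P" for S'
      unfolding ghost_deviation_def by (rule cSUP_upper[OF g bdd_above_ghost_deviation[OF S that]])
  qed (use sample_mean_integrable[OF g] in simp)
  finally show "expectation g - sample_mean n S g \<le> (\<integral>S'. ghost_deviation S' S \<partial>P)" .
qed

text \<open>
  A pair of samples as a single product over flagged positions, which makes the exchange of entries
  between the two samples a reindexing.
\<close>

definition double_sample :: "(nat \<times> bool \<Rightarrow> 'z) measure" where
  "double_sample = (\<Pi>\<^sub>M k\<in>{..<n} \<times> UNIV. D)"

text \<open>
  A constant \<open>b\<close> gives one of the two original samples, any other \<open>b\<close> a sample mixed from both.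
\<close>

definition half :: "(nat \<Rightarrow> bool) \<Rightarrow> (nat \<times> bool \<Rightarrow> 'z) \<Rightarrow> nat \<Rightarrow> 'z" where
  "half b \<omega> = (\<lambda>i\<in>{..<n}. \<omega> (i, b i))"

text \<open>
  However the choice \<open>b\<close> mixes the two copies, a half and its complementary half are two independent
  samples.
\<close>

lemma distr_halves:
  "distr double_sample (P \<Otimes>\<^sub>M P) (\<lambda>\<omega>. (half b \<omega>, half (\<lambda>i. \<not> b i) \<omega>)) = P \<Otimes>\<^sub>M P"
  unfolding double_sample_def half_def
  using n_pos by (intro distr_PiM_disjoint_reindex prob_space_axioms) (auto simp: inj_on_def lessThan_empty_iff)

lemma half_measurable [measurable]: "half b \<in> double_sample \<rightarrow>\<^sub>M P"
  unfolding double_sample_def half_def by (intro measurable_restrict) auto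

lemma half_space: "\<omega> \<in> space double_sample \<Longrightarrow> half b \<omega> \<in> space P"
  using measurable_space[OF half_measurable] .

lemma distr_half: "distr double_sample P (half b) = P"
  unfolding double_sample_def half_def
  by (intro distr_PiM_reindex[of _ "\<lambda>_. D", simplified] prob_space_axioms) (auto simp: inj_on_def)

text \<open>
  Exchanging the entries at which \<open>\<sigma> i = -1\<close> changes the sign of exactly these terms in the difference
  of the two sample means, which turns it into a difference of two signed sums over the unmixed copies.
\<close>

lemma ghost_deviation_half_le:
  assumes \<sigma>: "\<sigma> \<in> set_pmf (sign_pmf n)" and \<omega>: "\<omega> \<in> space double_sample"
  shows "ghost_deviation (half (\<lambda>i. \<sigma> i = 1) \<omega>) (half (\<lambda>i. \<sigma> i \<noteq> 1) \<omega>)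
      \<le> signed_sup (half (\<lambda>_. True) \<omega>) \<sigma> + signed_sup (half (\<lambda>_. False) \<omega>) \<sigma>"
  unfolding ghost_deviation_def
proof (rule cSUP_least[OF G_nonempty])
  fix g assume g: "g \<in> G"
  let ?s = "\<lambda>b. \<Sum>i<n. \<sigma> i * g (half (\<lambda>_. b) \<omega> i)"
  have sup: "\<bar>?s b\<bar> / real n \<le> signed_sup (half (\<lambda>_. b) \<omega>) \<sigma>" for b
    unfolding signed_sup_def
    using cSUP_upper[OF g bdd_above_signed[OF \<sigma> half_space[OF \<omega>]]] n_pos
    by (simp add: divide_right_mono)
  have "sample_mean n (half (\<lambda>i. \<sigma> i = 1) \<omega>) g - sample_mean n (half (\<lambda>i. \<sigma> i \<noteq> 1) \<omega>) g
      = (1 / real n) * (\<Sum>i<n. g (half (\<lambda>i. \<sigma> i = 1) \<omega> i) - g (half (\<lambda>i. \<sigma> i \<noteq> 1) \<omega> i))"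
    by (simp add: sample_mean_def sum_subtractf right_diff_distrib)
  also have "(\<Sum>i<n. g (half (\<lambda>i. \<sigma> i = 1) \<omega> i) - g (half (\<lambda>i. \<sigma> i \<noteq> 1) \<omega> i))
      = (\<Sum>i<n. \<sigma> i * g (half (\<lambda>_. True) \<omega> i) - \<sigma> i * g (half (\<lambda>_. False) \<omega> i))"
  proof (rule sum.cong)
    fix i assume "i \<in> {..<n}"
    then show "g (half (\<lambda>i. \<sigma> i = 1) \<omega> i) - g (half (\<lambda>i. \<sigma> i \<noteq> 1) \<omega> i)
        = \<sigma> i * g (half (\<lambda>_. True) \<omega> i) - \<sigma> i * g (half (\<lambda>_. False) \<omega> i)"
      using sign_cases[OF \<sigma>, of i] by (auto simp: half_def)
  qed simp
  also have "(1 / real n) * \<dots> = ?s True / real n - ?s False / real n"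
    by (simp add: sum_subtractf diff_divide_distrib)
  also have "\<dots> \<le> \<bar>?s True\<bar> / real n + \<bar>?s False\<bar> / real n"
    using n_pos by (simp add: diff_divide_distrib[symmetric] add_divide_distrib[symmetric] divide_right_mono)
  also have "\<dots> \<le> signed_sup (half (\<lambda>_. True) \<omega>) \<sigma> + signed_sup (half (\<lambda>_. False) \<omega>) \<sigma>"
    by (intro add_mono sup)
  finally show "sample_mean n (half (\<lambda>i. \<sigma> i = 1) \<omega>) g - sample_mean n (half (\<lambda>i. \<sigma> i \<noteq> 1) \<omega>) g
      \<le> signed_sup (half (\<lambda>_. True) \<omega>) \<sigma> + signed_sup (half (\<lambda>_. False) \<omega>) \<sigma>" .
qed

lemma ghost_deviation_integrable:
  "integrable (P \<Otimes>\<^sub>M P) (\<lambda>(S', S). ghost_deviation S' S)"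
  using ghost_deviation_measurable ghost_deviation_bound
  by (intro ghost.P.integrable_const_bound[where B = M])
     (auto simp: ghost_deviation_def space_pair_measure)

text \<open>
  The expected deviation from a ghost sample equals the expectation over every exchange of the two
  copies, hence also the average over random exchanges, where the signed sums of each copy contribute
  one Rademacher average.
\<close>

lemma symmetrization:
  "(\<integral>S. deviation S \<partial>P) \<le> 2 * (\<integral>S. rademacher n S G \<partial>P)"
proof -
  note [measurable] = rademacher_measurable
  let ?\<Sigma> = "set_pmf (sign_pmf n)" and ?p = "pmf (sign_pmf n)"
  let ?gd = "\<lambda>b \<omega>. ghost_deviation (half b \<omega>) (half (\<lambda>i. \<not> b i) \<omega>)"
  define I where "I = (\<integral>(S', S). ghost_deviation S' S \<partial>(P \<Otimes>\<^sub>M P))"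
  have pair_meas: "(\<lambda>\<omega>. (half b \<omega>, half (\<lambda>i. \<not> b i) \<omega>)) \<in> double_sample \<rightarrow>\<^sub>M P \<Otimes>\<^sub>M P" for b
    by measurable
  have gd_meas: "(\<lambda>(S', S). ghost_deviation S' S) \<in> borel_measurable (P \<Otimes>\<^sub>M P)"
    using ghost_deviation_measurable by (simp add: ghost_deviation_def)
  have gd_int: "integrable double_sample (?gd b)" for b
    using integrable_distr[OF pair_meas[of b], of "\<lambda>(S', S). ghost_deviation S' S"]
      ghost_deviation_integrable unfolding distr_halves by simp
  have gd_eq: "(\<integral>\<omega>. ?gd b \<omega> \<partial>double_sample) = I" for b
    using integral_distr[OF pair_meas[of b] gd_meas] unfolding distr_halves I_def by simp
  have "integrable P (\<lambda>S. rademacher n S G)"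
    by (rule sample.integrable_const_bound[where B = M])
       (use rademacher_range in fastforce)+
  then have rad_int: "integrable double_sample (\<lambda>\<omega>. rademacher n (half b \<omega>) G)" for b
    using integrable_distr[OF half_measurable[of b], of "\<lambda>S. rademacher n S G"]
    unfolding distr_half by simp
  have rad_eq: "(\<integral>\<omega>. rademacher n (half b \<omega>) G \<partial>double_sample) = (\<integral>S. rademacher n S G \<partial>P)" for b
    using integral_distr[OF half_measurable[of b] rademacher_measurable] unfolding distr_half by simp
  have "(\<integral>S. deviation S \<partial>P) \<le> (\<integral>S. (\<integral>S'. ghost_deviation S' S \<partial>P) \<partial>P)"
  proof (rule integral_mono)
    show "integrable P deviation"
      using deviation_measurable deviation_bound
      by (intro sample.integrable_const_bound[where B = M]) (auto simp: deviation_def[abs_def])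
    show "integrable P (\<lambda>S. \<integral>S'. ghost_deviation S' S \<partial>P)"
      using ghost.integrable_snd[OF ghost_deviation_integrable] .
  qed (rule deviation_le_ghost)
  also have "\<dots> = I"
    unfolding I_def using ghost.integral_snd[OF ghost_deviation_integrable] .
  \<comment> \<open>each exchange of the copies has the same integral \<open>I\<close>, so averaging over exchanges is harmless\<close>
  also have "I = (\<Sum>\<sigma>\<in>?\<Sigma>. ?p \<sigma> * (\<integral>\<omega>. ?gd (\<lambda>i. \<sigma> i = 1) \<omega> \<partial>double_sample))"
    by (simp add: gd_eq sum_distrib_right[symmetric] sum_sign_pmf)
  also have "\<dots> = (\<integral>\<omega>. (\<Sum>\<sigma>\<in>?\<Sigma>. ?p \<sigma> * ?gd (\<lambda>i. \<sigma> i = 1) \<omega>) \<partial>double_sample)"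
    using gd_int by (subst Bochner_Integration.integral_sum) auto
  also have "\<dots> \<le> (\<integral>\<omega>. rademacher n (half (\<lambda>_. True) \<omega>) G + rademacher n (half (\<lambda>_. False) \<omega>) G \<partial>double_sample)"
  proof (rule integral_mono)
    fix \<omega> assume "\<omega> \<in> space double_sample"
    then show "(\<Sum>\<sigma>\<in>?\<Sigma>. ?p \<sigma> * ?gd (\<lambda>i. \<sigma> i = 1) \<omega>)
        \<le> rademacher n (half (\<lambda>_. True) \<omega>) G + rademacher n (half (\<lambda>_. False) \<omega>) G"
      unfolding rademacher_eq sum.distrib[symmetric] distrib_left[symmetric]
      by (intro sum_mono mult_left_mono ghost_deviation_half_le) auto
  qed (use gd_int rad_int in auto)
  also have "\<dots> = 2 * (\<integral>S. rademacher n S G \<partial>P)"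
    using rad_int by (simp add: rad_eq)
  finally show ?thesis .
qed

section \<open>Concentration of the empirical minimizer\<close>

lemma fun_upd_sample_space: "S \<in> space P \<Longrightarrow> i < n \<Longrightarrow> z \<in> space D \<Longrightarrow> S(i := z) \<in> space P"
  by (auto simp: space_PiM PiE_iff extensional_def)

lemma sum_fun_upd:
  fixes h :: "nat \<Rightarrow> 'z \<Rightarrow> real"
  assumes "i < n"
  shows "(\<Sum>k<n. h k ((S(i := z)) k)) - (\<Sum>k<n. h k (S k)) = h i z - h i (S i)"
  using assms by (simp add: sum_subtractf[symmetric] sum.remove[of "{..<n}" i])

lemma G_diff: "\<lbrakk>g \<in> G; x \<in> space D; z \<in> space D\<rbrakk> \<Longrightarrow> \<bar>g x - g z\<bar> \<le> M"
  using G_range[of g x] G_range[of g z] by auto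

lemma sample_mean_diff:
  assumes "S \<in> space P" "i < n" "z \<in> space D" "g \<in> G"
  shows "\<bar>sample_mean n (S(i := z)) g - sample_mean n S g\<bar> \<le> M / real n"
proof -
  have "sample_mean n (S(i := z)) g - sample_mean n S g = (g z - g (S i)) / real n"
    unfolding sample_mean_def right_diff_distrib[symmetric] sum_fun_upd[OF assms(2), of "\<lambda>_. g"] by simp
  then show ?thesis
    using G_diff[OF assms(4,3) sample_space[OF assms(1,2)]] by (simp add: divide_right_mono)
qed

lemma deviation_diff:
  assumes "S \<in> space P" "i < n" "z \<in> space D"
  shows "\<bar>deviation (S(i := z)) - deviation S\<bar> \<le> M / real n"
  unfolding deviation_def
proof (rule abs_SUP_diff_le[OF G_nonempty])
  fix g assume "g \<in> G"
  then show "\<bar>(expectation g - sample_mean n (S(i := z)) g) - (expectation g - sample_mean n S g)\<bar> \<le> M / real n"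
    using sample_mean_diff[OF assms] by (simp add: abs_minus_commute)
qed (intro bdd_above_deviation fun_upd_sample_space assms)+

lemma signed_sup_diff:
  assumes \<sigma>: "\<sigma> \<in> set_pmf (sign_pmf n)" and S: "S \<in> space P" "i < n" "z \<in> space D"
  shows "\<bar>signed_sup (S(i := z)) \<sigma> - signed_sup S \<sigma>\<bar> \<le> M / real n"
proof -
  have "\<bar>(SUP g\<in>G. \<bar>\<Sum>k<n. \<sigma> k * g ((S(i := z)) k)\<bar>) - (SUP g\<in>G. \<bar>\<Sum>k<n. \<sigma> k * g (S k)\<bar>)\<bar> \<le> M"
  proof (rule abs_SUP_diff_le[OF G_nonempty])
    fix g assume g: "g \<in> G"
    have "\<bar>\<bar>\<Sum>k<n. \<sigma> k * g ((S(i := z)) k)\<bar> - \<bar>\<Sum>k<n. \<sigma> k * g (S k)\<bar>\<bar>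
        \<le> \<bar>(\<Sum>k<n. \<sigma> k * g ((S(i := z)) k)) - (\<Sum>k<n. \<sigma> k * g (S k))\<bar>"
      by (rule abs_triangle_ineq3)
    also have "\<dots> = \<bar>\<sigma> i * (g z - g (S i))\<bar>"
      using sum_fun_upd[OF S(2), of "\<lambda>k x. \<sigma> k * g x" S z] by (simp add: right_diff_distrib)
    also have "\<dots> = \<bar>g z - g (S i)\<bar>"
      using sign_cases[OF \<sigma> S(2)] by (auto simp: abs_mult)
    also have "\<dots> \<le> M" by (rule G_diff[OF g S(3) sample_space[OF S(1,2)]])
    finally show "\<bar>\<bar>\<Sum>k<n. \<sigma> k * g ((S(i := z)) k)\<bar> - \<bar>\<Sum>k<n. \<sigma> k * g (S k)\<bar>\<bar> \<le> M" .
  qed (intro bdd_above_signed \<sigma> fun_upd_sample_space S)+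
  then show ?thesis
    unfolding signed_sup_def right_diff_distrib[symmetric] abs_mult
    by (simp add: divide_right_mono del: fun_upd_apply)
qed

lemma rademacher_diff:
  assumes "S \<in> space P" "i < n" "z \<in> space D"
  shows "\<bar>rademacher n (S(i := z)) G - rademacher n S G\<bar> \<le> M / real n"
proof -
  let ?\<Sigma> = "set_pmf (sign_pmf n)" and ?p = "pmf (sign_pmf n)"
  have "\<bar>rademacher n (S(i := z)) G - rademacher n S G\<bar>
      = \<bar>\<Sum>\<sigma>\<in>?\<Sigma>. ?p \<sigma> * (signed_sup (S(i := z)) \<sigma> - signed_sup S \<sigma>)\<bar>"
    by (simp add: rademacher_eq sum_subtractf right_diff_distrib)
  also have "\<dots> \<le> (\<Sum>\<sigma>\<in>?\<Sigma>. \<bar>?p \<sigma> * (signed_sup (S(i := z)) \<sigma> - signed_sup S \<sigma>)\<bar>)"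
    by (rule sum_abs)
  also have "\<dots> \<le> (\<Sum>\<sigma>\<in>?\<Sigma>. ?p \<sigma> * (M / real n))"
    unfolding abs_mult abs_of_nonneg[OF pmf_nonneg]
    by (intro sum_mono mult_left_mono signed_sup_diff assms) auto
  also have "\<dots> = M / real n"
    unfolding sum_distrib_right[symmetric] sum_sign_pmf by simp
  finally show ?thesis .
qed

text \<open>
  Combining all random terms into a single function \<open>h\<close> makes one application of McDiarmid's inequality
  enough: the sample mean and the deviation contribute \<open>M / n\<close> each to its differences, and twice the
  Rademacher average contributes \<open>2 M / n\<close>.
\<close>

lemma excess_tail:
  assumes g: "g \<in> G" and M: "M > 0" and t: "t > 0"
  shows "measure P {S \<in> space P.
      sample_mean n S g - expectation g + deviation S - 2 * rademacher n S G \<ge> t}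
    \<le> exp (- real n * t\<^sup>2 / (8 * M\<^sup>2))"
proof -
  define h where "h S = sample_mean n S g - expectation g + deviation S - 2 * rademacher n S G" for S
  note [measurable] = rademacher_measurable sample_mean_measurable[OF g]
  have [measurable]: "deviation \<in> borel_measurable P"
    using deviation_measurable by (simp add: deviation_def[abs_def])
  have h_meas: "h \<in> borel_measurable P" unfolding h_def by measurable
  have h_bound: "\<bar>h S\<bar> \<le> 4 * M" if S: "S \<in> space P" for S
    using sample_mean_range[OF S g] expectation_range[OF g] deviation_bound[OF S] rademacher_range[OF S]
    unfolding h_def by (auto simp: abs_le_iff)
  have h_diff: "\<bar>h (S(i := z)) - h S\<bar> \<le> 4 * M / real n"
    if S: "S \<in> space P" "i \<in> {..<n}" "z \<in> space D" for S i z
  proof -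
    have i: "i < n" using S(2) by simp
    show ?thesis
      using sample_mean_diff[OF S(1) i S(3) g] deviation_diff[OF S(1) i S(3)] rademacher_diff[OF S(1) i S(3)]
      unfolding h_def abs_le_iff by linarith
  qed
  have "integrable P deviation" "integrable P (\<lambda>S. rademacher n S G)"
    by (rule sample.integrable_const_bound[where B = M],
        use deviation_bound rademacher_range in fastforce,
        use rademacher_measurable in measurable)+
  then have mean: "(\<integral>S. h S \<partial>P) \<le> 0"
    using symmetrization sample_mean_integrable[OF g] expectation_sample_mean[OF g]
    unfolding h_def by (simp add: sample.prob_space)
  have C: "(\<Sum>i<n. (4 * M / real n)\<^sup>2) = 16 * M\<^sup>2 / real n"
    using n_pos by (simp add: power2_eq_square field_simps)
  \<comment> \<open>by \<open>mean\<close>, exceeding \<open>t\<close> entails exceeding the expectation by \<open>t\<close>\<close>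
  have "measure P {S \<in> space P. h S \<ge> t} \<le> measure P {S \<in> space P. h S \<ge> (\<integral>S. h S \<partial>P) + t}"
    using mean h_meas by (intro sample.finite_measure_mono) auto
  also have "\<dots> \<le> exp (- 2 * t\<^sup>2 / (\<Sum>i<n. (4 * M / real n)\<^sup>2))"
    by (rule McDiarmid_inequality[where B = "4 * M"])
       (use prob_space_axioms h_meas h_bound h_diff t M n_pos in \<open>auto simp: C simp del: sum_constant\<close>)
  also have "\<dots> = exp (- real n * t\<^sup>2 / (8 * M\<^sup>2))"
    unfolding C using M n_pos by (simp add: field_simps)
  finally show ?thesis unfolding h_def .
qed

text \<open>
  The population minimizer \<open>g\<close> is at least as good on average as the empirical choice \<open>a S\<close>, so its
  empirical disadvantage is due only to its own fluctuation and to the deviation at \<open>a S\<close>, and the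
  function in the preceding tail bound controls exactly this sum. The radius is chosen so that the
  exponent becomes \<open>- L\<close>. For \<open>M = 0\<close> all members of the class vanish on the space and the radius is \<open>0\<close>.
\<close>

theorem population_minimizer_near_empirical:
  assumes g: "g \<in> G" and opt: "\<And>g'. g' \<in> G \<Longrightarrow> expectation g \<le> expectation g'"
    and a: "\<And>S. S \<in> space P \<Longrightarrow> a S \<in> G"
    and a_meas [measurable]: "(\<lambda>S. sample_mean n S (a S)) \<in> borel_measurable P"
    and L: "L > 0"
  shows "measure P {S \<in> space P. sample_mean n S g
        \<le> sample_mean n S (a S) + 2 * rademacher n S G + 4 * M * sqrt (L / (2 * real n))}
      \<ge> 1 - exp (- L)" (is "measure P ?A \<ge> _")
proof (cases "M > 0")
  case False
  have "?A = space P"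
  proof safe
    fix S assume S: "S \<in> space P"
    have "M = 0" using False expectation_range[OF g] by simp
    then show "sample_mean n S g
        \<le> sample_mean n S (a S) + 2 * rademacher n S G + 4 * M * sqrt (L / (2 * real n))"
      using sample_mean_range[OF S g] sample_mean_range[OF S a[OF S]] rademacher_range[OF S] by simp
  qed
  then show ?thesis by (simp add: sample.prob_space)
next
  case True
  define t where "t = 4 * M * sqrt (L / (2 * real n))"
  have t: "t > 0" using True L n_pos by (simp add: t_def)
  note [measurable] = rademacher_measurable sample_mean_measurable[OF g]
  have [measurable]: "deviation \<in> borel_measurable P"
    using deviation_measurable by (simp add: deviation_def[abs_def])
  let ?B = "{S \<in> space P. sample_mean n S g - expectation g + deviation S - 2 * rademacher n S G \<ge> t}"
  have "space P - ?B \<subseteq> ?A"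
  proof safe
    fix S assume S: "S \<in> space P"
      and *: "\<not> t \<le> sample_mean n S g - expectation g + deviation S - 2 * rademacher n S G"
    have "expectation (a S) - sample_mean n S (a S) \<le> deviation S"
      unfolding deviation_def by (rule cSUP_upper[OF a[OF S] bdd_above_deviation[OF S]])
    with * opt[OF a[OF S]]
    show "sample_mean n S g \<le> sample_mean n S (a S) + 2 * rademacher n S G + 4 * M * sqrt (L / (2 * real n))"
      unfolding t_def by linarith
  qed
  then have "measure P (space P - ?B) \<le> measure P ?A"
    by (intro sample.finite_measure_mono) auto
  moreover have "measure P (space P - ?B) = 1 - measure P ?B"
    by (intro sample.prob_compl) auto
  moreover have "measure P ?B \<le> exp (- real n * t\<^sup>2 / (8 * M\<^sup>2))"
    by (rule excess_tail[OF g True t])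
  moreover have "- real n * t\<^sup>2 / (8 * M\<^sup>2) = - L"
    unfolding t_def using True L n_pos by (simp add: power_mult_distrib field_simps)
  ultimately show ?thesis by simp
qed

end

section \<open>Covering the test labels\<close>

lemma borel_measurable_pinball [measurable]:
  assumes [measurable]: "u \<in> borel_measurable D" "v \<in> borel_measurable D"
  shows "(\<lambda>z. pinball \<tau> (u z) (v z)) \<in> borel_measurable D"
  unfolding pinball_def by measurable

lemma (in product_prob_space) measure_PiM_all:
  assumes "finite I" "\<And>i. i \<in> I \<Longrightarrow> A i \<in> sets (M i)"
  shows "measure (PiM I M) {x \<in> space (PiM I M). \<forall>i\<in>I. x i \<in> A i} = (\<Prod>i\<in>I. measure (M i) (A i))"
proof -
  have "{x \<in> space (PiM I M). \<forall>i\<in>I. x i \<in> A i} = prod_emb I M I (Pi\<^sub>E I A)"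
    using assms(2)[THEN sets.sets_into_space] by (auto simp: prod_emb_def space_PiM PiE_iff restrict_def extensional_def)
  then show ?thesis
    using measure_PiM_emb[of I A] assms by simp
qed

lemma (in prob_space) prob_Int3_ge:
  assumes "A \<in> events" "B \<in> events" "C \<in> events"
  shows "prob (A \<inter> B \<inter> C) \<ge> prob A + prob B + prob C - 2"
proof -
  have "1 - prob (A \<inter> B \<inter> C) = prob (space M - (A \<inter> B \<inter> C))"
    using assms by (subst prob_compl) auto
  also have "space M - (A \<inter> B \<inter> C) = (space M - A) \<union> ((space M - B) \<union> (space M - C))" by auto
  also have "prob \<dots> \<le> prob (space M - A) + (prob (space M - B) + prob (space M - C))"
    using assms by (intro order.trans[OF measure_Un_le] add_mono order.refl measure_Un_le) auto
  also have "\<dots> = (1 - prob A) + ((1 - prob B) + (1 - prob C))"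
    using assms by (simp add: prob_compl)
  finally show ?thesis by simp
qed

lemma (in pair_prob_space) measure_pair_Times:
  assumes "A \<in> sets M1" "B \<in> sets M2"
  shows "measure (M1 \<Otimes>\<^sub>M M2) (A \<times> B) = measure M1 A * measure M2 B"
  using M2.emeasure_pair_measure_Times[OF assms]
  by (simp add: measure_def enn2real_mult)

text \<open>
  The extended endpoints of the box are at least as wide as those obtained from the single members
  \<open>\<beta>1\<close> and \<open>\<beta>2\<close> and from single error values in \<open>E\<close>. The error values show that \<open>E\<close> is nonempty, so
  \<open>sup0 E\<close> is a genuine supremum.
\<close>

lemma uncertainty_set_memI:
  assumes \<beta>: "\<beta>1 \<in> \<B>" "\<beta>2 \<in> \<B>"
    and l: "\<And>j. \<bar>l j - \<beta>1 (xt j)\<bar> \<in> E" and h: "\<And>j. \<bar>h j - \<beta>2 (xt j)\<bar> \<in> E"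
    and u: "\<And>j. l j \<le> u $ j" "\<And>j. u $ j \<le> h j"
  shows "u \<in> uncertainty_set \<B> E xt"
  unfolding uncertainty_set_def
proof (intro CollectI allI conjI)
  fix j
  have e: "ereal e \<le> sup0 E" if "e \<in> E" for e
    using that by (auto simp: sup0_def intro!: Sup_upper)
  have "(INF \<beta>\<in>\<B>. ereal (\<beta> (xt j))) - sup0 E \<le> ereal (\<beta>1 (xt j)) - ereal \<bar>l j - \<beta>1 (xt j)\<bar>"
    by (intro ereal_minus_mono e l INF_lower \<beta>)
  also have "\<dots> \<le> ereal (u $ j)" using u(1)[of j] by simp
  finally show "(INF \<beta>\<in>\<B>. ereal (\<beta> (xt j))) - sup0 E \<le> ereal (u $ j)" .
  have "ereal (u $ j) \<le> ereal (\<beta>2 (xt j)) + ereal \<bar>h j - \<beta>2 (xt j)\<bar>" using u(2)[of j] by simp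
  also have "\<dots> \<le> (SUP \<beta>\<in>\<B>. ereal (\<beta> (xt j))) + sup0 E"
    by (intro add_mono e h SUP_upper \<beta>)
  finally show "ereal (u $ j) \<le> (SUP \<beta>\<in>\<B>. ereal (\<beta> (xt j))) + sup0 E" .
qed

text \<open>
  Disintegration along the features: for almost every \<open>x\<close>, the labels below the upper quantile are those
  below the lower quantile, of conditional mass \<open>p\<close>, together with labels in between, so the latter
  have conditional mass at least \<open>q - p\<close>.
\<close>

lemma measure_between_quantiles_ge:
  fixes X :: "'x::topological_space set"
  assumes D: "prob_space D" "sets D = sets (restrict_space borel X \<Otimes>\<^sub>M restrict_space borel Y)"
    and cond: "is_cond_dist X Y D \<kappa>"
    and p: "AE x in feature_dist X D. \<P>(y in \<kappa> x. y \<le> l x) = p"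
    and q: "AE x in feature_dist X D. \<P>(y in \<kappa> x. y \<le> h x) = q"
    and meas: "{z \<in> space D. l (fst z) < snd z \<and> snd z \<le> h (fst z)} \<in> sets D"
    and "p \<le> q"
  shows "measure D {z \<in> space D. l (fst z) < snd z \<and> snd z \<le> h (fst z)} \<ge> q - p"
proof -
  let ?A = "{z \<in> space D. l (fst z) < snd z \<and> snd z \<le> h (fst z)}"
  interpret D: prob_space D by fact
  have spD: "space D = X \<times> Y"
    using sets_eq_imp_space_eq[OF D(2)] by (simp add: space_pair_measure space_restrict_space)
  have "fst \<in> D \<rightarrow>\<^sub>M restrict_space borel X"
    unfolding measurable_cong_sets[OF D(2) refl] by measurable
  then interpret F: prob_space "feature_dist X D"
    unfolding feature_dist_def by (rule D.prob_space_distr)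
  have spF: "space (feature_dist X D) = X"
    by (simp add: feature_dist_def space_restrict_space)
  have "AE x in feature_dist X D. ennreal (q - p) \<le> emeasure (\<kappa> x) (Pair x -` ?A)"
    using p q AE_space
  proof eventually_elim
    case (elim x)
    have "\<kappa> x \<in> space (prob_algebra (restrict_space borel Y))"
      using cond elim(3) unfolding is_cond_dist_def
      by (auto simp: spF space_restrict_space dest: measurable_space)
    then interpret K: prob_space "\<kappa> x"
      by (auto simp: space_prob_algebra)
    have sets: "sets (\<kappa> x) = sets (restrict_space borel Y)"
      using \<open>\<kappa> x \<in> space (prob_algebra _)\<close> by (simp add: space_prob_algebra)
    have sp: "space (\<kappa> x) = Y"
      using sets_eq_imp_space_eq[OF sets] by (simp add: space_restrict_space)
    have [measurable]: "(\<lambda>y. y) \<in> borel_measurable (\<kappa> x)"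
      unfolding measurable_cong_sets[OF sets refl] by (rule measurable_restrict_space1) simp
    let ?B = "{y \<in> space (\<kappa> x). l x < y \<and> y \<le> h x}"
    have "q \<le> measure (\<kappa> x) ({y \<in> space (\<kappa> x). y \<le> l x} \<union> ?B)"
      unfolding elim(2)[symmetric] by (intro K.finite_measure_mono) auto
    also have "\<dots> \<le> p + measure (\<kappa> x) ?B"
      unfolding elim(1)[symmetric] by (intro measure_Un_le) auto
    finally have "q - p \<le> measure (\<kappa> x) ?B" by simp
    moreover have "Pair x -` ?A = ?B"
      using elim(3) by (auto simp: spD spF sp)
    ultimately show ?case by (simp add: K.emeasure_eq_measure)
  qed
  then have "(\<integral>\<^sup>+x. ennreal (q - p) \<partial>feature_dist X D) \<le> (\<integral>\<^sup>+x. emeasure (\<kappa> x) (Pair x -` ?A) \<partial>feature_dist X D)"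
    by (rule nn_integral_mono_AE)
  also have "\<dots> = emeasure D ?A"
    using cond meas by (simp add: is_cond_dist_def)
  finally show ?thesis
    using \<open>p \<le> q\<close> by (simp add: F.emeasure_space_1 D.emeasure_eq_measure)
qed

theorem theorem7p1:
  fixes X :: "(real ^ 'd) set" and Y :: "real set"
    and D :: "((real ^ 'd) \<times> real) measure" and \<kappa> :: "real ^ 'd \<Rightarrow> real measure"
    and n :: nat and \<delta>p \<delta>q \<delta> M :: real
    and \<B>0 :: "(real ^ 'd \<Rightarrow> real) set"
    and \<beta>star :: "real \<Rightarrow> real ^ 'd \<Rightarrow> real"
    and \<beta>alg :: "real \<Rightarrow> (nat \<Rightarrow> (real ^ 'd) \<times> real) \<Rightarrow> real ^ 'd \<Rightarrow> real"
    and \<mu> :: "real \<Rightarrow> real ^ 'd \<Rightarrow> real"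
    and E :: "real \<Rightarrow> real set" and \<delta>e :: "real \<Rightarrow> real"
    and Dec :: "(real ^ 'd1) set"
    and f :: "real ^ 'd1 \<Rightarrow> real ^ 'm \<Rightarrow> real"
    and F :: "real ^ 'd1 \<Rightarrow> real ^ 'm \<Rightarrow> real ^ 'd2"
    and K :: "(real ^ 'd2) set"
    and \<pi>star :: "(nat \<Rightarrow> (real ^ 'd) \<times> real) \<Rightarrow> ('m \<Rightarrow> real ^ 'd) \<Rightarrow> real ^ 'd1"
  assumes D: "prob_space D" "sets D = sets (restrict_space borel X \<Otimes>\<^sub>M restrict_space borel Y)"
    and cond: "is_cond_dist X Y D \<kappa>"
    and n: "n \<ge> 1"
    and levels: "0 \<le> \<delta>p" "\<delta>p \<le> \<delta>q" "\<delta>q \<le> 1"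
    and \<delta>: "0 < \<delta>" "\<delta> < 1"
    and \<B>0: "\<And>\<beta>. \<beta> \<in> \<B>0 \<Longrightarrow> \<beta> \<in> restrict_space borel X \<rightarrow>\<^sub>M restrict_space borel Y"
    and bounded: "\<And>\<tau> \<beta> x y. \<lbrakk>\<tau> \<in> {\<delta>p, \<delta>q}; \<beta> \<in> \<B>0; x \<in> X; y \<in> Y\<rbrakk> \<Longrightarrow> pinball \<tau> (\<beta> x) y \<in> {0..M}"
    and \<beta>star: "\<And>\<tau>. \<tau> \<in> {\<delta>p, \<delta>q} \<Longrightarrow> is_arg_min (pop_risk D \<tau>) (\<lambda>\<beta>. \<beta> \<in> \<B>0) (\<beta>star \<tau>)"
    and \<beta>alg: "\<And>\<tau> S. \<lbrakk>\<tau> \<in> {\<delta>p, \<delta>q}; S \<in> space (\<Pi>\<^sub>M i\<in>{..<n}. D)\<rbrakk>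
      \<Longrightarrow> is_arg_min (emp_risk n S \<tau>) (\<lambda>\<beta>. \<beta> \<in> \<B>0) (\<beta>alg \<tau> S)"
    and quantile: "\<And>\<tau>. \<tau> \<in> {\<delta>p, \<delta>q} \<Longrightarrow>
      AE x in feature_dist X D. ereal (\<mu> \<tau> x) = cond_quantile \<kappa> \<tau> x \<and> \<P>(y in \<kappa> x. y \<le> \<mu> \<tau> x) = \<tau>"
    and E: "\<And>\<tau>. \<tau> \<in> {\<delta>p, \<delta>q} \<Longrightarrow> E \<tau> \<subseteq> Y"
    and \<delta>e: "\<And>\<tau>. \<tau> \<in> {\<delta>p, \<delta>q} \<Longrightarrow> 0 \<le> \<delta>e \<tau> \<and> \<delta>e \<tau> \<le> 1"
    and err: "\<And>\<tau>. \<tau> \<in> {\<delta>p, \<delta>q} \<Longrightarrow>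
      \<P>(x in feature_dist X D. \<bar>\<mu> \<tau> x - \<beta>star \<tau> x\<bar> \<in> E \<tau>) \<ge> 1 - \<delta>e \<tau>"
    and K: "convex_cone K"
    and \<pi>star: "\<And>S xt. \<lbrakk>S \<in> space (\<Pi>\<^sub>M i\<in>{..<n}. D); \<And>j. xt j \<in> X\<rbrakk> \<Longrightarrow>
      robust_optimal Dec f F K
        (uncertainty_set (confidence_class n M \<delta> \<B>0 \<delta>p S (\<beta>alg \<delta>p S)
                          \<union> confidence_class n M \<delta> \<B>0 \<delta>q S (\<beta>alg \<delta>q S)) (E \<delta>p \<union> E \<delta>q) xt)
        (\<pi>star S xt)"
    \<comment> \<open>measurability of the suprema, selections and events involved\<close>
    and meas_\<mu>: "\<And>\<tau>. \<tau> \<in> {\<delta>p, \<delta>q} \<Longrightarrow> \<mu> \<tau> \<in> borel_measurable (restrict_space borel X)"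
    and meas_err: "\<And>\<tau>. \<tau> \<in> {\<delta>p, \<delta>q} \<Longrightarrow>
      {x \<in> space (feature_dist X D). \<bar>\<mu> \<tau> x - \<beta>star \<tau> x\<bar> \<in> E \<tau>} \<in> sets (feature_dist X D)"
    and meas_rademacher: "\<And>\<tau>. \<tau> \<in> {\<delta>p, \<delta>q} \<Longrightarrow>
      (\<lambda>S. rademacher n S (loss_class \<tau> \<B>0)) \<in> borel_measurable (\<Pi>\<^sub>M i\<in>{..<n}. D)"
    and meas_dev: "\<And>\<tau>. \<tau> \<in> {\<delta>p, \<delta>q} \<Longrightarrow>
      (\<lambda>S. SUP \<beta>\<in>\<B>0. pop_risk D \<tau> \<beta> - emp_risk n S \<tau> \<beta>) \<in> borel_measurable (\<Pi>\<^sub>M i\<in>{..<n}. D)"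
    and meas_dev2: "\<And>\<tau>. \<tau> \<in> {\<delta>p, \<delta>q} \<Longrightarrow>
      (\<lambda>(S', S). SUP \<beta>\<in>\<B>0. emp_risk n S' \<tau> \<beta> - emp_risk n S \<tau> \<beta>)
        \<in> borel_measurable ((\<Pi>\<^sub>M i\<in>{..<n}. D) \<Otimes>\<^sub>M (\<Pi>\<^sub>M i\<in>{..<n}. D))"
    and meas_\<beta>alg: "\<And>\<tau>. \<tau> \<in> {\<delta>p, \<delta>q} \<Longrightarrow>
      (\<lambda>S. emp_risk n S \<tau> (\<beta>alg \<tau> S)) \<in> borel_measurable (\<Pi>\<^sub>M i\<in>{..<n}. D)"
    and meas_\<pi>star:
      "{(S, T) \<in> space ((\<Pi>\<^sub>M i\<in>{..<n}. D) \<Otimes>\<^sub>M (\<Pi>\<^sub>M j\<in>(UNIV :: 'm set). D)).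
          F (\<pi>star S (\<lambda>j. fst (T j))) (\<chi> j. snd (T j)) \<in> K}
       \<in> sets ((\<Pi>\<^sub>M i\<in>{..<n}. D) \<Otimes>\<^sub>M (\<Pi>\<^sub>M j\<in>(UNIV :: 'm set). D))"
  shows "(\<forall>\<tau> \<in> {\<delta>p, \<delta>q}.
      \<P>(S in (\<Pi>\<^sub>M i\<in>{..<n}. D). \<beta>star \<tau> \<in> confidence_class n M \<delta> \<B>0 \<tau> S (\<beta>alg \<tau> S)) \<ge> 1 - \<delta>)
    \<and> \<P>(\<omega> in (\<Pi>\<^sub>M i\<in>{..<n}. D) \<Otimes>\<^sub>M (\<Pi>\<^sub>M j\<in>(UNIV :: 'm set). D).
          F (\<pi>star (fst \<omega>) (\<lambda>j. fst (snd \<omega> j))) (\<chi> j. snd (snd \<omega> j)) \<in> K)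
      \<ge> (1 - \<delta>) * ((1 - \<delta>e \<delta>p) ^ CARD('m) + (1 - \<delta>e \<delta>q) ^ CARD('m))
        + (\<delta>q - \<delta>p) ^ CARD('m) - 2"
proof -
  interpret D: prob_space D by fact
  let ?P = "\<Pi>\<^sub>M i\<in>{..<n}. D" and ?Q = "\<Pi>\<^sub>M j\<in>(UNIV :: 'm set). D"
  let ?T = "{\<delta>p, \<delta>q}"
  have spD: "space D = X \<times> Y"
    using sets_eq_imp_space_eq[OF D(2)] by (simp add: space_pair_measure space_restrict_space)
  have fst_meas [measurable]: "fst \<in> D \<rightarrow>\<^sub>M restrict_space borel X"
    unfolding measurable_cong_sets[OF D(2) refl] by measurable
  have snd_meas: "snd \<in> D \<rightarrow>\<^sub>M restrict_space borel Y"
    unfolding measurable_cong_sets[OF D(2) refl] by measurable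
  have snd_borel [measurable]: "snd \<in> borel_measurable D"
    using measurable_compose[OF snd_meas, of "\<lambda>y. y" borel] by (simp add: measurable_restrict_space1)
  have \<beta>_meas: "(\<lambda>z. \<beta> (fst z)) \<in> borel_measurable D" if "\<beta> \<in> \<B>0" for \<beta>
    using measurable_compose[OF fst_meas measurable_compose[OF \<B>0[OF that], of "\<lambda>y. y" borel]]
    by (simp add: measurable_restrict_space1)
  have spF: "space (feature_dist X D) = X" and setsF: "sets (feature_dist X D) = sets (restrict_space borel X)"
    by (simp_all add: feature_dist_def space_restrict_space)
  have \<beta>star_in: "\<beta>star \<tau> \<in> \<B>0" if "\<tau> \<in> ?T" for \<tau>
    using \<beta>star[OF that] by (simp add: is_arg_min_def)

  \<comment> \<open>risks of predictors as means of members of the loss class\<close>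
  define loss where "loss \<tau> \<beta> = (\<lambda>z. pinball \<tau> (\<beta> (fst z)) (snd z))"
    for \<tau> and \<beta> :: "real ^ 'd \<Rightarrow> real"
  have class_eq: "loss_class \<tau> \<B>0 = loss \<tau> ` \<B>0" for \<tau>
    by (simp add: loss_class_def loss_def)
  have pop_eq: "pop_risk D \<tau> \<beta> = D.expectation (loss \<tau> \<beta>)" for \<tau> \<beta>
    by (simp add: pop_risk_def loss_def)
  have emp_eq: "emp_risk n S \<tau> \<beta> = sample_mean n S (loss \<tau> \<beta>)" for S \<tau> \<beta>
    by (simp add: emp_risk_def sample_mean_def loss_def)

  let ?conf = "\<lambda>\<tau> S. confidence_class n M \<delta> \<B>0 \<tau> S (\<beta>alg \<tau> S)"
  let ?A = "\<lambda>\<tau>. {S \<in> space ?P. \<beta>star \<tau> \<in> ?conf \<tau> S}"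
  have A_sets: "?A \<tau> \<in> sets ?P" and A_prob: "measure ?P (?A \<tau>) \<ge> 1 - \<delta>" if \<tau>: "\<tau> \<in> ?T" for \<tau>
  proof -
    interpret C: bounded_class D n "loss_class \<tau> \<B>0" M
    proof
      show "n \<ge> 1" by (rule n)
      show "loss_class \<tau> \<B>0 \<noteq> {}" using \<beta>star_in[OF \<tau>] by (auto simp: class_eq)
      show "g \<in> borel_measurable D" if "g \<in> loss_class \<tau> \<B>0" for g
        using that unfolding class_eq loss_def
        by (auto intro!: borel_measurable_pinball \<beta>_meas snd_borel)
      show "g z \<in> {0..M}" if "g \<in> loss_class \<tau> \<B>0" "z \<in> space D" for g z
        using that bounded[OF \<tau>] by (auto simp: class_eq loss_def spD simp del: atLeastAtMost_iff)
      show "(\<lambda>S. rademacher n S (loss_class \<tau> \<B>0)) \<in> borel_measurable ?P"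
        by (rule meas_rademacher[OF \<tau>])
      show "(\<lambda>S. SUP g\<in>loss_class \<tau> \<B>0. D.expectation g - sample_mean n S g) \<in> borel_measurable ?P"
        using meas_dev[OF \<tau>] by (simp add: class_eq pop_eq emp_eq image_image)
      show "(\<lambda>(S', S). SUP g\<in>loss_class \<tau> \<B>0. sample_mean n S' g - sample_mean n S g)
          \<in> borel_measurable (?P \<Otimes>\<^sub>M ?P)"
        using meas_dev2[OF \<tau>] by (simp add: class_eq emp_eq image_image)
    qed
    have g: "loss \<tau> (\<beta>star \<tau>) \<in> loss_class \<tau> \<B>0"
      using \<beta>star_in[OF \<tau>] by (auto simp: class_eq)
    have A_eq: "?A \<tau> = {S \<in> space ?P. sample_mean n S (loss \<tau> (\<beta>star \<tau>))
        \<le> sample_mean n S (loss \<tau> (\<beta>alg \<tau> S)) + 2 * rademacher n S (loss_class \<tau> \<B>0)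
          + 4 * M * sqrt (ln (3 / \<delta>) / (2 * real n))}"
      using \<beta>star_in[OF \<tau>] by (simp add: confidence_class_def emp_eq)
    have [measurable]: "(\<lambda>S. sample_mean n S (loss \<tau> (\<beta>alg \<tau> S))) \<in> borel_measurable ?P"
      using meas_\<beta>alg[OF \<tau>] by (simp add: emp_eq)
    note [measurable] = meas_rademacher[OF \<tau>] C.sample_mean_measurable[OF g]
    show "?A \<tau> \<in> sets ?P" unfolding A_eq by measurable
    have "1 - exp (- ln (3 / \<delta>)) \<le> measure ?P (?A \<tau>)"
      unfolding A_eq
    proof (rule C.population_minimizer_near_empirical[OF g])
      show "D.expectation (loss \<tau> (\<beta>star \<tau>)) \<le> D.expectation g'" if "g' \<in> loss_class \<tau> \<B>0" for g'
        using that \<beta>star[OF \<tau>] by (auto simp: class_eq is_arg_min_linorder pop_eq)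
      show "loss \<tau> (\<beta>alg \<tau> S) \<in> loss_class \<tau> \<B>0" if "S \<in> space ?P" for S
        using \<beta>alg[OF \<tau> that] by (auto simp: class_eq is_arg_min_def)
    qed (use \<delta> in auto)
    then show "measure ?P (?A \<tau>) \<ge> 1 - \<delta>"
      using \<delta> by (simp add: exp_minus)
  qed

  interpret Q: product_prob_space "\<lambda>_ :: 'm. D" UNIV
    by (simp add: D(1) product_prob_spaceI)
  interpret P: prob_space ?P by (intro prob_space_PiM D(1))
  interpret W: pair_prob_space ?P ?Q ..
  have Q_all: "{T \<in> space ?Q. \<forall>j. T j \<in> A} \<in> sets ?Q"
    "measure ?Q {T \<in> space ?Q. \<forall>j. T j \<in> A} = measure D A ^ CARD('m)" if "A \<in> sets D" for A
    using Q.measure_PiM_all[of "\<lambda>_. A"] that by (simp_all, measurable)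

  \<comment> \<open>\<open>?C \<tau>\<close>: at every test point the minimizer is as close to the quantile as \<open>E \<tau>\<close> requires\<close>
  let ?c = "\<lambda>\<tau>. {z \<in> space D. \<bar>\<mu> \<tau> (fst z) - \<beta>star \<tau> (fst z)\<bar> \<in> E \<tau>}"
  let ?C = "\<lambda>\<tau>. {T \<in> space ?Q. \<forall>j. T j \<in> ?c \<tau>}"
  have c: "?c \<tau> \<in> sets D" "measure D (?c \<tau>) \<ge> 1 - \<delta>e \<tau>" if \<tau>: "\<tau> \<in> ?T" for \<tau>
  proof -
    let ?N = "{x \<in> space (feature_dist X D). \<bar>\<mu> \<tau> x - \<beta>star \<tau> x\<bar> \<in> E \<tau>}"
    have N: "?N \<in> sets (restrict_space borel X)" using meas_err[OF \<tau>] unfolding setsF .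
    have eq: "?c \<tau> = fst -` ?N \<inter> space D" by (auto simp: spF spD)
    show "?c \<tau> \<in> sets D" unfolding eq by (rule measurable_sets[OF fst_meas N])
    show "measure D (?c \<tau>) \<ge> 1 - \<delta>e \<tau>"
      using err[OF \<tau>] measure_distr[OF fst_meas N] unfolding eq feature_dist_def by simp
  qed
  have AC_sets: "?A \<tau> \<times> ?C \<tau> \<in> sets (?P \<Otimes>\<^sub>M ?Q)"
    and AC: "measure (?P \<Otimes>\<^sub>M ?Q) (?A \<tau> \<times> ?C \<tau>) \<ge> (1 - \<delta>) * (1 - \<delta>e \<tau>) ^ CARD('m)"
    if \<tau>: "\<tau> \<in> ?T" for \<tau>
  proof -
    show "?A \<tau> \<times> ?C \<tau> \<in> sets (?P \<Otimes>\<^sub>M ?Q)"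
      by (intro pair_measureI A_sets Q_all c \<tau>)
    have "(1 - \<delta>) * (1 - \<delta>e \<tau>) ^ CARD('m) \<le> measure ?P (?A \<tau>) * measure D (?c \<tau>) ^ CARD('m)"
      using \<delta> \<delta>e[OF \<tau>] c(2)[OF \<tau>] by (intro mult_mono power_mono A_prob \<tau>) auto
    then show "measure (?P \<Otimes>\<^sub>M ?Q) (?A \<tau> \<times> ?C \<tau>) \<ge> (1 - \<delta>) * (1 - \<delta>e \<tau>) ^ CARD('m)"
      unfolding W.measure_pair_Times[OF A_sets[OF \<tau>] Q_all(1)[OF c(1)[OF \<tau>]]] Q_all(2)[OF c(1)[OF \<tau>]] .
  qed

  \<comment> \<open>\<open>?I\<close>: every test label lies between the two quantiles\<close>
  let ?i = "{z \<in> space D. \<mu> \<delta>p (fst z) < snd z \<and> snd z \<le> \<mu> \<delta>q (fst z)}"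
  let ?I = "{T \<in> space ?Q. \<forall>j. T j \<in> ?i}"
  have \<mu>_fst: "(\<lambda>z. \<mu> \<tau> (fst z)) \<in> borel_measurable D" if "\<tau> \<in> ?T" for \<tau>
    by (rule measurable_compose[OF fst_meas meas_\<mu>[OF that]])
  have [measurable]: "(\<lambda>z. \<mu> \<delta>p (fst z)) \<in> borel_measurable D" "(\<lambda>z. \<mu> \<delta>q (fst z)) \<in> borel_measurable D"
    by (simp_all add: \<mu>_fst)
  have i_sets: "?i \<in> sets D" by measurable
  have i: "measure D ?i \<ge> \<delta>q - \<delta>p"
    by (rule measure_between_quantiles_ge[OF D cond _ _ i_sets levels(2)])
       (use quantile[of \<delta>p] quantile[of \<delta>q] in auto)
  have I_sets: "space ?P \<times> ?I \<in> sets (?P \<Otimes>\<^sub>M ?Q)"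
    by (intro pair_measureI Q_all i_sets) simp
  have I: "measure (?P \<Otimes>\<^sub>M ?Q) (space ?P \<times> ?I) \<ge> (\<delta>q - \<delta>p) ^ CARD('m)"
    unfolding W.measure_pair_Times[OF sets.top Q_all(1)[OF i_sets]] Q_all(2)[OF i_sets]
    using i levels by (simp add: P.prob_space power_mono)

  let ?G = "{\<omega> \<in> space (?P \<Otimes>\<^sub>M ?Q). F (\<pi>star (fst \<omega>) (\<lambda>j. fst (snd \<omega> j))) (\<chi> j. snd (snd \<omega> j)) \<in> K}"
  have G_sets: "?G \<in> sets (?P \<Otimes>\<^sub>M ?Q)"
    using meas_\<pi>star by (simp add: case_prod_unfold)
  have "?A \<delta>p \<times> ?C \<delta>p \<inter> ?A \<delta>q \<times> ?C \<delta>q \<inter> space ?P \<times> ?I \<subseteq> ?G"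
  proof safe
    fix S T
    assume S: "S \<in> space ?P" and T: "T \<in> space ?Q"
      and conf: "\<beta>star \<delta>p \<in> ?conf \<delta>p S" "\<beta>star \<delta>q \<in> ?conf \<delta>q S"
      and C: "\<forall>j. T j \<in> ?c \<delta>p" "\<forall>j. T j \<in> ?c \<delta>q" and I: "\<forall>j. T j \<in> ?i"
    show "(S, T) \<in> space (?P \<Otimes>\<^sub>M ?Q)" using S T by (simp add: space_pair_measure)
    let ?U = "uncertainty_set (?conf \<delta>p S \<union> ?conf \<delta>q S) (E \<delta>p \<union> E \<delta>q) (\<lambda>j. fst (T j))"
    have "(\<chi> j. snd (T j)) \<in> ?U"
      by (rule uncertainty_set_memI[of "\<beta>star \<delta>p" _ "\<beta>star \<delta>q" "\<lambda>j. \<mu> \<delta>p (fst (T j))" _ _ "\<lambda>j. \<mu> \<delta>q (fst (T j))"])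
         (use conf C I in \<open>auto intro: less_imp_le\<close>)
    moreover have "fst (T j) \<in> X" for j
      using I spD by (auto simp: mem_Times_iff)
    then have "robust_optimal Dec f F K ?U (\<pi>star S (\<lambda>j. fst (T j)))"
      by (intro \<pi>star S)
    ultimately show "F (\<pi>star (fst (S, T)) (\<lambda>j. fst (snd (S, T) j))) (\<chi> j. snd (snd (S, T) j)) \<in> K"
      by (auto simp: robust_optimal_def is_arg_min_def robust_feasible_def)
  qed
  then have "measure (?P \<Otimes>\<^sub>M ?Q) (?A \<delta>p \<times> ?C \<delta>p \<inter> ?A \<delta>q \<times> ?C \<delta>q \<inter> space ?P \<times> ?I) \<le> measure (?P \<Otimes>\<^sub>M ?Q) ?G"
    by (rule W.P.finite_measure_mono[OF _ G_sets])
  moreover have "measure (?P \<Otimes>\<^sub>M ?Q) (?A \<delta>p \<times> ?C \<delta>p \<inter> ?A \<delta>q \<times> ?C \<delta>q \<inter> space ?P \<times> ?I)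
      \<ge> measure (?P \<Otimes>\<^sub>M ?Q) (?A \<delta>p \<times> ?C \<delta>p) + measure (?P \<Otimes>\<^sub>M ?Q) (?A \<delta>q \<times> ?C \<delta>q)
        + measure (?P \<Otimes>\<^sub>M ?Q) (space ?P \<times> ?I) - 2"
    by (intro W.P.prob_Int3_ge AC_sets I_sets) auto
  ultimately have "measure (?P \<Otimes>\<^sub>M ?Q) ?G \<ge> (1 - \<delta>) * ((1 - \<delta>e \<delta>p) ^ CARD('m) + (1 - \<delta>e \<delta>q) ^ CARD('m))
        + (\<delta>q - \<delta>p) ^ CARD('m) - 2"
    using AC[of \<delta>p] AC[of \<delta>q] I by (simp add: distrib_left)
  with A_prob show ?thesis by blast
qed

end
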